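(* Let $V$ be an optimal prefix-free machine and let $T>0$ be real. Define $\overline{\Theta}_V(T)=\sum_{s\in\{0,1\}^*,\,H_V(s)<T|s|}2^{-|s|}$. Then: (i) if $T$ is left-computable and $0<T\le 1$, then $\overline{\Theta}_V(T)$ is a left-computable real which is weakly Chaitin $T$-random; (ii) if $T$ is computable and $0<T<1$, then $\overline{\Theta}_V(T)$ is strictly $T$-compressible; (iii) if $1<T$, then $\overline{\Theta}_V(T)$ diverges to $\infty$.
   Context: $\{0,1\}^*$ is the set of finite binary strings; $|s|$ is the length of $s$. A prefix-free machine is a partial recursive function $C:\{0,1\}^*\to\{0,1\}^*$ whose domain is prefix-free. $H_C(s)=\min\{|p| : C(p)=s\}$ (possibly $\infty$). A prefix-free machine $U$ is optimal if for every prefix-free machine $C$ there is $d\in\mathbb{N}$ such that for every $p\in\mathrm{Dom}\,C$ there is $q\in\mathrm{Dom}\,U$ with $U(q)=C(p)$ and $|q|\le|p|+d$. A particular optimal prefix-free machine $U$ is fixed and $H(s):=H_U(s)$. For a real $\alpha$ and $n\ge1$, $\alpha\restriction n$ denotes the first $n$ bits of the base-two expansion of $\alpha-\lfloor\alpha\rfloor$ (the expansion with infinitely many zeros). A real $\alpha$ is computable if there is a total recursive $f:\mathbb{N}^+\to\mathbb{Q}$ with $|\alpha-f(n)|<1/n$ for all $n$; right-computable if there is a total recursive $f:\mathbb{N}^+\to\mathbb{Q}$ with $\alpha\le f(n)$ for all $n$ and $f(n)\to\alpha$; left-computable if $-\alpha$ is right-computable. For $T\in(0,1]$, $\alpha$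 is weakly Chaitin $T$-random if there is $c\in\mathbb{N}$ with $Tn-c\le H(\alpha\restriction n)$ for all $n\in\mathbb{N}^+$; $\alpha$ is strictly $T$-compressible if there is $d\in\mathbb{N}$ with $H(\alpha\restriction n)\le Tn+d$ for all $n\in\mathbb{N}^+$. *)

theory Defs
  imports "HOL-Analysis.Analysis" "HOL-Library.Extended_Real" "HOL-Library.Extended_Nat"
begin

datatype recf =
    Zero
  | Succ
  | Proj nat
  | Comp recf "recf list"
  | Prim recf recf
  | Mu recf

inductive eval :: "recf \<Rightarrow> nat list \<Rightarrow> nat \<Rightarrow> bool" where
  eval_Zero: "eval Zero xs 0"
| eval_Succ: "eval Succ (x # xs) (Suc x)"
| eval_Proj: "i < length xs \<Longrightarrow> eval (Proj i) xs (xs ! i)"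
| eval_Comp: "list_all2 (\<lambda>g y. eval g xs y) gs ys \<Longrightarrow> eval f ys z \<Longrightarrow> eval (Comp f gs) xs z"
| eval_Prim0: "eval f xs y \<Longrightarrow> eval (Prim f g) (0 # xs) y"
| eval_PrimS: "eval (Prim f g) (n # xs) y \<Longrightarrow> eval g (n # y # xs) z
      \<Longrightarrow> eval (Prim f g) (Suc n # xs) z"
| eval_Mu: "eval f (n # xs) 0 \<Longrightarrow> (\<forall>m<n. \<exists>y. y > 0 \<and> eval f (m # xs) y)
      \<Longrightarrow> eval (Mu f) xs n"

definition partial_recursive :: "(nat \<Rightarrow> nat option) \<Rightarrow> bool" where
  "partial_recursive \<phi> \<longleftrightarrow> (\<exists>r. \<forall>x y. \<phi> x = Some y \<longleftrightarrow> eval r [x] y)"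

definition total_recursive :: "(nat \<Rightarrow> nat) \<Rightarrow> bool" where
  "total_recursive f \<longleftrightarrow> partial_recursive (\<lambda>x. Some (f x))"

type_synonym bits = "bool list"

text \<open>Bijective numbering of binary strings (bijective base-2).\<close>
fun code_bits :: "bits \<Rightarrow> nat" where
  "code_bits [] = 0"
| "code_bits (b # bs) = 2 * code_bits bs + (if b then 2 else 1)"

definition partial_recursive_bits :: "(bits \<Rightarrow> bits option) \<Rightarrow> bool" where
  "partial_recursive_bits C \<longleftrightarrow>
     partial_recursive (\<lambda>x. if \<exists>p. code_bits p = x
        then map_option code_bits (C (THE p. code_bits p = x)) else None)"

definition prefix_free :: "bits set \<Rightarrow> bool" where
  "prefix_free A \<longleftrightarrow> (\<forall>p\<in>A. \<forall>q\<in>A. (\<exists>r. q = p @ r) \<longrightarrow> p = q)"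

definition prefix_free_machine :: "(bits \<Rightarrow> bits option) \<Rightarrow> bool" where
  "prefix_free_machine C \<longleftrightarrow> partial_recursive_bits C \<and> prefix_free (dom C)"

definition H_C :: "(bits \<Rightarrow> bits option) \<Rightarrow> bits \<Rightarrow> enat" where
  "H_C C s = (INF p\<in>{p. C p = Some s}. enat (length p))"

definition optimal_machine :: "(bits \<Rightarrow> bits option) \<Rightarrow> bool" where
  "optimal_machine U \<longleftrightarrow> prefix_free_machine U \<and>
     (\<forall>C. prefix_free_machine C \<longrightarrow>
        (\<exists>d::nat. \<forall>p\<in>dom C. \<exists>q\<in>dom U. U q = C p \<and> length q \<le> length p + d))"

text \<open>alpha|n: first n bits of the base-two expansion (with infinitely many zeros)
  of the fractional part of alpha; bit k (k \<ge> 1) is floor(frac alpha * 2^k) mod 2.\<close>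
definition restr :: "real \<Rightarrow> nat \<Rightarrow> bits" where
  "restr \<alpha> n = map (\<lambda>k. odd \<lfloor>frac \<alpha> * 2 ^ k\<rfloor>) [1..<Suc n]"

definition recursive_rat_seq :: "(nat \<Rightarrow> rat) \<Rightarrow> bool" where
  "recursive_rat_seq f \<longleftrightarrow> (\<exists>sg num den. total_recursive sg \<and> total_recursive num \<and>
      total_recursive den \<and>
      (\<forall>n. f n = (if sg n = 0 then 1 else -1) * of_nat (num n) / of_nat (den n + 1)))"

definition computable_real :: "real \<Rightarrow> bool" where
  "computable_real \<alpha> \<longleftrightarrow> (\<exists>f. recursive_rat_seq f \<and>
      (\<forall>n\<ge>1. \<bar>\<alpha> - of_rat (f n)\<bar> < 1 / real n))"

definition right_computable :: "real \<Rightarrow> bool" where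
  "right_computable \<alpha> \<longleftrightarrow> (\<exists>f. recursive_rat_seq f \<and>
      (\<forall>n\<ge>1. \<alpha> \<le> of_rat (f n)) \<and> ((\<lambda>n. of_rat (f n)) \<longlonglongrightarrow> \<alpha>))"

definition left_computable :: "real \<Rightarrow> bool" where
  "left_computable \<alpha> \<longleftrightarrow> right_computable (- \<alpha>)"

text \<open>Randomness notions relative to the fixed optimal machine U (H = H_U).\<close>
definition weakly_chaitin_random :: "(bits \<Rightarrow> bits option) \<Rightarrow> real \<Rightarrow> real \<Rightarrow> bool" where
  "weakly_chaitin_random U T \<alpha> \<longleftrightarrow>
     (\<exists>c::nat. \<forall>n\<ge>1. ereal (T * real n - real c) \<le> ereal_of_enat (H_C U (restr \<alpha> n)))"

definition strictly_compressible :: "(bits \<Rightarrow> bits option) \<Rightarrow> real \<Rightarrow> real \<Rightarrow> bool" where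
  "strictly_compressible U T \<alpha> \<longleftrightarrow>
     (\<exists>d::nat. \<forall>n\<ge>1. ereal_of_enat (H_C U (restr \<alpha> n)) \<le> ereal (T * real n + real d))"

text \<open>Theta-bar_V(T) = sum over s with H_V(s) < T|s| of 2^(-|s|), as an extended
  nonnegative real (= \<infinity> iff the series diverges).\<close>
definition Theta_bar :: "(bits \<Rightarrow> bits option) \<Rightarrow> real \<Rightarrow> ennreal" where
  "Theta_bar V T = (\<Sum>\<^sub>\<infinity> s\<in>{s. ereal_of_enat (H_C V s) < ereal (T * real (length s))}.
      ennreal ((1/2) ^ length s))"

end

theory Submission
  imports Defs
begin

text \<open>The set of strings \<open>s\<close> with \<open>H\<^sub>V(s) < T|s|\<close> is recursively enumerable when \<open>T\<close> is left-computable,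
  so its weight \<open>\<theta>\<close> is the limit of an increasing recursive sequence of dyadic partial sums \<open>\<theta>\<^sub>t\<close>;
  Kraft's inequality gives \<open>\<theta> \<le> 1/2\<close> for \<open>T \<le> 1\<close>.

  Randomness: from the first \<open>n\<close> bits of \<open>\<theta>\<close> one finds a stage \<open>t\<close> with
  \<open>\<theta> - \<theta>\<^sub>t < 2 / 2\<^sup>n\<close>. By then every member of length \<open>n - 1\<close> has been enumerated, so one can compute a
  string of length \<open>n - 1\<close> outside the set, whose complexity is at least \<open>T (n - 1)\<close>.
  Allowing two units in the last place keeps the search terminating even if \<open>\<theta>\<close> is dyadic.

  Compressibility: request a program of length about \<open>T n\<close> for the first \<open>n\<close> bits of \<open>\<theta>\<^sub>t\<close> whenever they
  change. A string \<open>s\<close> is responsible for at most \<open>min 1 2\<^bsup>n - |s|\<^esup>\<close> changes at level \<open>n\<close>, and for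
  \<open>0 < T < 1\<close> the sum of \<open>2\<^bsup>-T n\<^esup> min 1 2\<^bsup>n - |s|\<^esup>\<close> over \<open>n\<close> is a constant times \<open>2\<^bsup>-T |s|\<^esup>\<close>, which is at most
  the weight of a \<open>V\<close>-program of \<open>s\<close>. Hence the total weight of the requests is finite and the Kraft--Chaitin
  theorem provides the programs.

  Divergence: for \<open>T > 1\<close> the Kraft--Chaitin theorem puts all sufficiently long strings into the set.\<close>

section \<open>Total recursive functions\<close>

inductive_cases eval_ZeroE: "eval Zero xs y"
inductive_cases eval_SuccE: "eval Succ xs y"
inductive_cases eval_ProjE: "eval (Proj i) xs y"
inductive_cases eval_CompE: "eval (Comp f gs) xs z"
inductive_cases eval_PrimE: "eval (Prim f g) xs y"
inductive_cases eval_Prim0E: "eval (Prim f g) (0 # xs) y"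
inductive_cases eval_PrimSE: "eval (Prim f g) (Suc n # xs) z"
inductive_cases eval_MuE: "eval (Mu f) xs n"

text \<open>The delicate case is \<open>Mu\<close>: of two different results the smaller would be an
  argument at which \<open>f\<close> takes both the value 0 and a positive one.\<close>

lemma eval_det: "eval r xs y \<Longrightarrow> eval r xs z \<Longrightarrow> y = z"
proof (induction arbitrary: z rule: eval.induct)
  case (eval_Comp xs gs ys f z')
  from eval_Comp.prems obtain ys' where ys': "list_all2 (\<lambda>g y. eval g xs y) gs ys'" "eval f ys' z"
    by (rule eval_CompE)
  have "ys = ys'"
    using eval_Comp.IH(1) ys'(1)
    by (auto simp: list_all2_conv_all_nth intro!: nth_equalityI)
  then show ?case using eval_Comp.IH(2) ys'(2) by blast
next
  case (eval_PrimS f g n xs y z')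
  from eval_PrimS.prems obtain y' where "eval (Prim f g) (n # xs) y'" "eval g (n # y' # xs) z"
    by (rule eval_PrimSE)
  then show ?case using eval_PrimS.IH by metis
next
  case (eval_Mu f n xs)
  from eval_Mu.prems have z: "eval f (z # xs) 0" "\<forall>m<z. \<exists>y. y > 0 \<and> eval f (m # xs) y"
    by (auto elim: eval_MuE)
  show ?case
  proof (rule linorder_cases[of n z])
    assume "n < z"
    then show ?thesis using z(2) eval_Mu.IH(1) by fastforce
  next
    assume "z < n"
    then show ?thesis using z(1) eval_Mu.IH(2) by fastforce
  qed
next
  case (eval_Prim0 f xs y g)
  from eval_Prim0.prems have "eval f xs z" by (rule eval_Prim0E)
  then show ?case by (rule eval_Prim0.IH)
next
  case (eval_Zero xs)
  then show ?case by (rule eval_ZeroE) simp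
next
  case (eval_Succ x xs)
  then show ?case by (rule eval_SuccE) simp
next
  case (eval_Proj i xs)
  from eval_Proj.prems show ?case by (rule eval_ProjE) simp
qed

text \<open>Functions of several arguments are functions of the argument list; inside \<open>recfun k\<close> the variables
  are written \<open>hd xs\<close>, \<open>hd (tl xs)\<close>, and so on, so that the rules below apply by higher-order pattern
  unification and a binder simply pushes a new head onto the list.\<close>

definition recfun :: "nat \<Rightarrow> (nat list \<Rightarrow> nat) \<Rightarrow> bool" where
  "recfun k f \<longleftrightarrow> (\<exists>r. \<forall>xs. length xs = k \<longrightarrow> eval r xs (f xs))"

lemma recfun_cong:
  assumes "\<And>xs. length xs = k \<Longrightarrow> f xs = g xs" "recfun k g"
  shows "recfun k f"
proof -
  from assms(2) obtain r where "\<forall>xs. length xs = k \<longrightarrow> eval r xs (g xs)"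
    unfolding recfun_def by blast
  with assms(1) show ?thesis unfolding recfun_def by (intro exI[of _ r]) simp
qed

lemma recfun_nth: "i < k \<Longrightarrow> recfun k (\<lambda>xs. xs ! i)"
  unfolding recfun_def by (intro exI[of _ "Proj i"]) (simp add: eval_Proj)

lemma recfun_comp:
  assumes g: "recfun (length fs) g" and fs: "\<forall>f\<in>set fs. recfun k f"
  shows "recfun k (\<lambda>xs. g (map (\<lambda>f. f xs) fs))"
proof -
  obtain r where r: "\<And>xs. length xs = length fs \<Longrightarrow> eval r xs (g xs)"
    using g unfolding recfun_def by blast
  have "\<forall>f\<in>set fs. \<exists>s. \<forall>xs. length xs = k \<longrightarrow> eval s xs (f xs)"
    using fs unfolding recfun_def by blast
  then obtain s where s: "\<And>f xs. f \<in> set fs \<Longrightarrow> length xs = k \<Longrightarrow> eval (s f) xs (f xs)"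
    by metis
  have "eval (Comp r (map s fs)) xs (g (map (\<lambda>f. f xs) fs))" if "length xs = k" for xs
    by (rule eval_Comp[of _ _ "map (\<lambda>f. f xs) fs"])
      (use s that r in \<open>auto simp: list_all2_conv_all_nth\<close>)
  then show ?thesis unfolding recfun_def by blast
qed

lemma recfun_Suc:
  assumes "recfun k f"
  shows "recfun k (\<lambda>xs. Suc (f xs))"
proof -
  have "recfun (length [f]) (\<lambda>xs. Suc (hd xs))"
    unfolding recfun_def by (intro exI[of _ Succ]) (auto simp: length_Suc_conv intro: eval_Succ)
  from recfun_comp[OF this, of k] show ?thesis using assms by simp
qed

lemma recfun_const: "recfun k (\<lambda>xs. c)"
proof (induction c)
  case 0
  then show ?case unfolding recfun_def using eval_Zero by blast
next
  case (Suc c)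
  then show ?case by (rule recfun_Suc)
qed

lemma recfun_hd:
  "recfun (Suc k) (\<lambda>xs. hd xs)"
  "recfun (Suc (Suc k)) (\<lambda>xs. hd (tl xs))"
  "recfun (Suc (Suc (Suc k))) (\<lambda>xs. hd (tl (tl xs)))"
  "recfun (Suc (Suc (Suc (Suc k)))) (\<lambda>xs. hd (tl (tl (tl xs))))"
proof -
  have drop: "(tl ^^ i) xs = drop i xs" for i and xs :: "nat list"
    by (induction i) (auto simp: drop_Suc tl_drop)
  have eq: "recfun n (\<lambda>xs. hd ((tl ^^ i) xs))" if "i < n" for i n
  proof (rule recfun_cong[OF _ recfun_nth[OF that]])
    fix xs :: "nat list" assume "length xs = n"
    then show "hd ((tl ^^ i) xs) = xs ! i"
      using that by (simp add: drop hd_drop_conv_nth)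
  qed
  show "recfun (Suc k) (\<lambda>xs. hd xs)" using eq[of 0 "Suc k"] by simp
  show "recfun (Suc (Suc k)) (\<lambda>xs. hd (tl xs))" using eq[of 1 "Suc (Suc k)"] by simp
  show "recfun (Suc (Suc (Suc k))) (\<lambda>xs. hd (tl (tl xs)))"
    using eq[of 2 "Suc (Suc (Suc k))"] by (simp add: eval_nat_numeral)
  show "recfun (Suc (Suc (Suc (Suc k)))) (\<lambda>xs. hd (tl (tl (tl xs))))"
    using eq[of 3 "Suc (Suc (Suc (Suc k)))"] by (simp add: eval_nat_numeral)
qed

text \<open>Only the leading arguments are replaced; those behind the first \<open>j\<close> are
  passed on by projections. This covers weakening as well as rearranging the variables bound by a
  sum or a recursion.\<close>

lemma recfun_comp_drop:
  assumes g: "recfun (length fs + k) g" and fs: "\<forall>f\<in>set fs. recfun (j + k) f"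
  shows "recfun (j + k) (\<lambda>xs. g (map (\<lambda>f. f xs) fs @ drop j xs))"
proof -
  let ?ps = "fs @ map (\<lambda>i xs. xs ! (j + i)) [0..<k]"
  have "recfun (j + k) (\<lambda>xs. g (map (\<lambda>f. f xs) ?ps))"
    by (rule recfun_comp) (use assms recfun_nth in auto)
  then show ?thesis
    by (rule recfun_cong[rotated]) (auto simp: o_def intro!: arg_cong[of _ _ g] nth_equalityI)
qed

lemma recfun_tl: "recfun k f \<Longrightarrow> recfun (Suc k) (\<lambda>xs. f (tl xs))"
  using recfun_comp_drop[of "[]" k f 1] by (simp add: drop_Suc)

text \<open>The step of \<open>recfun_rec_nat\<close> sees the counter, the accumulator and then the
  outer arguments. This rule lets a function of counter and outer arguments skip the
  accumulator.\<close>

lemma recfun_drop_snd: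
  assumes "recfun (Suc k) (\<lambda>xs. f (hd xs) (tl xs))"
  shows "recfun (Suc (Suc k)) (\<lambda>xs. f (hd xs) (tl (tl xs)))"
  using recfun_comp_drop[of "[\<lambda>xs. hd xs]" k "\<lambda>xs. f (hd xs) (tl xs)" 2] assms recfun_hd
  by (simp add: drop_Suc eval_nat_numeral)

text \<open>\<open>Prim\<close> recurses on the first entry of its list, so the recursion is built
  with a fresh leading argument, for which the bound \<open>b\<close> is then substituted.\<close>

lemma recfun_rec_nat:
  assumes b: "recfun k b" and a: "recfun k a"
    and g: "recfun (Suc (Suc k)) (\<lambda>ys. g (hd ys) (hd (tl ys)) (tl (tl ys)))"
  shows "recfun k (\<lambda>xs. rec_nat (a xs) (\<lambda>n y. g n y xs) (b xs))"
proof -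
  obtain ra where ra: "\<And>xs. length xs = k \<Longrightarrow> eval ra xs (a xs)"
    using a unfolding recfun_def by blast
  obtain rg where rg: "\<And>ys. length ys = Suc (Suc k) \<Longrightarrow> eval rg ys (g (hd ys) (hd (tl ys)) (tl (tl ys)))"
    using g unfolding recfun_def by blast
  have prim: "eval (Prim ra rg) (n # xs) (rec_nat (a xs) (\<lambda>n y. g n y xs) n)"
    if "length xs = k" for n xs
  proof (induction n)
    case 0
    then show ?case using ra[OF that] by (auto intro: eval_Prim0)
  next
    case (Suc n)
    then show ?case using rg[of "n # _ # xs"] that by (auto intro: eval_PrimS)
  qed
  then have "recfun (Suc k) (\<lambda>ys. rec_nat (a (tl ys)) (\<lambda>n y. g n y (tl ys)) (hd ys))"
    unfolding recfun_def by (intro exI[of _ "Prim ra rg"]) (auto simp: length_Suc_conv)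
  then have "recfun (length (b # map (\<lambda>i xs. xs ! i) [0..<k])) (\<lambda>ys. rec_nat (a (tl ys)) (\<lambda>n y. g n y (tl ys)) (hd ys))"
    by simp
  from recfun_comp[OF this, of k]
  have "recfun k (\<lambda>xs. (\<lambda>ys. rec_nat (a (tl ys)) (\<lambda>n y. g n y (tl ys)) (hd ys))
     (map (\<lambda>f. f xs) (b # map (\<lambda>i xs. xs ! i) [0..<k])))"
    using b recfun_nth by simp
  then show ?thesis
  proof (rule recfun_cong[rotated])
    fix xs :: "nat list" assume "length xs = k"
    then have "map (\<lambda>f. f xs) (map (\<lambda>i xs. xs ! i) [0..<k]) = xs"
      by (auto simp: o_def intro!: nth_equalityI)
    then show "rec_nat (a xs) (\<lambda>n y. g n y xs) (b xs) =
      (\<lambda>ys. rec_nat (a (tl ys)) (\<lambda>n y. g n y (tl ys)) (hd ys))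
        (map (\<lambda>f. f xs) (b # map (\<lambda>i xs. xs ! i) [0..<k]))"
      by simp
  qed
qed

section \<open>Arithmetic, decidable predicates and bounded quantifiers\<close>

lemma recfun_add:
  assumes "recfun k f" "recfun k g"
  shows "recfun k (\<lambda>xs. f xs + g xs)"
proof -
  have "rec_nat b (\<lambda>_ z. Suc z) a = a + b" for a b
    by (induction a) auto
  moreover have "recfun k (\<lambda>xs. rec_nat (g xs) (\<lambda>_ z. Suc z) (f xs))"
    by (intro recfun_rec_nat assms recfun_Suc recfun_hd)
  ultimately show ?thesis by simp
qed

lemma recfun_mult:
  assumes "recfun k f" "recfun k g"
  shows "recfun k (\<lambda>xs. f xs * g xs)"
proof -
  have "rec_nat 0 (\<lambda>_ z. z + b) a = a * b" for a b :: nat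
    by (induction a) auto
  moreover have "recfun k (\<lambda>xs. rec_nat 0 (\<lambda>_ z. z + g xs) (f xs))"
    by (intro recfun_rec_nat assms recfun_add recfun_const recfun_hd recfun_tl)
  ultimately show ?thesis by simp
qed

lemma recfun_power:
  assumes "recfun k f" "recfun k g"
  shows "recfun k (\<lambda>xs. f xs ^ g xs)"
proof -
  have "rec_nat 1 (\<lambda>_ z. b * z) a = b ^ a" for a b :: nat
    by (induction a) auto
  moreover have "recfun k (\<lambda>xs. rec_nat 1 (\<lambda>_ z. f xs * z) (g xs))"
    by (intro recfun_rec_nat assms recfun_mult recfun_const recfun_hd recfun_tl)
  ultimately show ?thesis by simp
qed

lemma recfun_diff:
  assumes "recfun k f" "recfun k g"
  shows "recfun k (\<lambda>xs. f xs - g xs)"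
proof -
  have "rec_nat 0 (\<lambda>n _. n) a = a - 1" for a :: nat
    by (cases a) auto
  then have pred: "recfun k' (\<lambda>xs. h xs - 1)" if "recfun k' h" for h k'
    using recfun_rec_nat[OF that recfun_const[of _ 0], of "\<lambda>n _ _. n"] recfun_hd by simp
  have "rec_nat b (\<lambda>_ z. z - 1) a = b - a" for a b :: nat
    by (induction a) auto
  moreover have "recfun k (\<lambda>xs. rec_nat (f xs) (\<lambda>_ z. z - 1) (g xs))"
    by (intro recfun_rec_nat assms pred recfun_hd)
  ultimately show ?thesis by simp
qed

lemma recfun_sum:
  assumes "recfun k b" "recfun (Suc k) (\<lambda>ys. f (hd ys) (tl ys))"
  shows "recfun k (\<lambda>xs. \<Sum>i<b xs. f i xs)"
proof -
  have "rec_nat 0 (\<lambda>i z. z + h i) a = sum h {..<a}" for a and h :: "nat \<Rightarrow> nat"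
    by (induction a) auto
  moreover have "recfun k (\<lambda>xs. rec_nat 0 (\<lambda>i z. z + f i xs) (b xs))"
    by (intro recfun_rec_nat assms recfun_add recfun_const recfun_hd recfun_drop_snd)
  ultimately show ?thesis by simp
qed

definition recpred :: "nat \<Rightarrow> (nat list \<Rightarrow> bool) \<Rightarrow> bool" where
  "recpred k P \<longleftrightarrow> recfun k (\<lambda>xs. of_bool (P xs))"

lemma recfun_of_bool: "recpred k P \<Longrightarrow> recfun k (\<lambda>xs. of_bool (P xs))"
  by (simp add: recpred_def)

lemma recpred_not:
  assumes "recpred k P"
  shows "recpred k (\<lambda>xs. \<not> P xs)"
proof -
  have "recfun k (\<lambda>xs. 1 - of_bool (P xs))"
    by (intro recfun_diff recfun_const recfun_of_bool assms)
  then show ?thesis unfolding recpred_def by (rule recfun_cong[rotated]) simp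
qed

lemma recpred_conj:
  assumes "recpred k P" "recpred k Q"
  shows "recpred k (\<lambda>xs. P xs \<and> Q xs)"
proof -
  have "recfun k (\<lambda>xs. of_bool (P xs) * of_bool (Q xs))"
    by (intro recfun_mult recfun_of_bool assms)
  then show ?thesis unfolding recpred_def by (rule recfun_cong[rotated]) simp
qed

lemma recpred_disj:
  assumes "recpred k P" "recpred k Q"
  shows "recpred k (\<lambda>xs. P xs \<or> Q xs)"
  using recpred_not[OF recpred_conj[OF recpred_not[OF assms(1)] recpred_not[OF assms(2)]]] by simp

lemma recpred_le:
  assumes "recfun k f" "recfun k g"
  shows "recpred k (\<lambda>xs. f xs \<le> g xs)"
proof -
  have "recfun k (\<lambda>xs. 1 - (f xs - g xs))"
    by (intro recfun_diff recfun_const assms)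
  then show ?thesis unfolding recpred_def by (rule recfun_cong[rotated]) simp
qed

lemma recpred_less:
  assumes "recfun k f" "recfun k g"
  shows "recpred k (\<lambda>xs. f xs < g xs)"
  using recpred_not[OF recpred_le[OF assms(2,1)]] by (simp add: not_le)

lemma recpred_eq:
  assumes "recfun k f" "recfun k g"
  shows "recpred k (\<lambda>xs. f xs = g xs)"
proof -
  have "(\<lambda>xs. f xs = g xs) = (\<lambda>xs. f xs \<le> g xs \<and> g xs \<le> f xs)" by auto
  then show ?thesis using recpred_conj[OF recpred_le[OF assms] recpred_le[OF assms(2,1)]] by simp
qed

lemma recpred_const: "recpred k (\<lambda>xs. c)"
  unfolding recpred_def by (rule recfun_const)

lemma recfun_if:
  assumes "recpred k P" "recfun k f" "recfun k g"
  shows "recfun k (\<lambda>xs. if P xs then f xs else g xs)"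
proof -
  have "recfun k (\<lambda>xs. of_bool (P xs) * f xs + of_bool (\<not> P xs) * g xs)"
    by (intro recfun_add recfun_mult recfun_of_bool recpred_not assms)
  then show ?thesis by (rule recfun_cong[rotated]) simp
qed

lemma recpred_ball:
  assumes "recfun k b" "recpred (Suc k) (\<lambda>ys. P (hd ys) (tl ys))"
  shows "recpred k (\<lambda>xs. \<forall>i<b xs. P i xs)"
proof -
  have "recpred k (\<lambda>xs. (\<Sum>i<b xs. of_bool (\<not> P i xs)) = (0::nat))"
    by (intro recpred_eq recfun_sum recfun_of_bool recpred_not recfun_const assms)
  moreover have "(\<Sum>i<n. of_bool (\<not> Q i)) = (0::nat) \<longleftrightarrow> (\<forall>i<n. Q i)" for n and Q :: "nat \<Rightarrow> bool"
    by (subst sum_eq_0_iff) auto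
  ultimately show ?thesis by simp
qed

lemma recpred_bex:
  assumes "recfun k b" "recpred (Suc k) (\<lambda>ys. P (hd ys) (tl ys))"
  shows "recpred k (\<lambda>xs. \<exists>i<b xs. P i xs)"
  using recpred_not[OF recpred_ball[OF assms(1) recpred_not[OF assms(2)]]] by simp

lemma recfun_div:
  assumes "recfun k f" "recfun k g"
  shows "recfun k (\<lambda>xs. f xs div g xs)"
proof -
  \<comment> \<open>The quotient counts the \<open>q\<close> whose next multiple
    \<open>Suc q * b\<close> still fits below \<open>a\<close>; the guard yields
    \<open>a div 0 = 0\<close>.\<close>
  have "(\<Sum>q<a. of_bool (0 < b \<and> Suc q * b \<le> a)) = a div b" for a b :: nat
  proof (cases "b = 0")
    case False
    have "Suc q * b \<le> a \<longleftrightarrow> q < a div b" for q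
      using less_eq_div_iff_mult_less_eq[of b "Suc q" a] False by (simp add: Suc_le_eq)
    then have "(\<Sum>q<a. of_bool (0 < b \<and> Suc q * b \<le> a)) = (\<Sum>q<a. of_bool (q < a div b) :: nat)"
      using False by (intro sum.cong) simp_all
    also have "\<dots> = (\<Sum>q<a div b. 1)"
      by (rule sum.mono_neutral_cong_right) (auto intro: less_le_trans)
    finally show ?thesis by simp
  qed simp
  moreover have "recfun k (\<lambda>xs. \<Sum>q<f xs. of_bool (0 < g xs \<and> Suc q * g xs \<le> f xs))"
    by (intro recfun_sum recfun_of_bool recpred_conj recpred_less recpred_le recfun_mult
        recfun_Suc recfun_const recfun_hd assms recfun_tl)
  ultimately show ?thesis by simp
qed

lemma recfun_mod:
  assumes "recfun k f" "recfun k g"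
  shows "recfun k (\<lambda>xs. f xs mod g xs)"
  unfolding minus_div_mult_eq_mod[symmetric]
  by (intro recfun_diff recfun_mult recfun_div assms)

lemmas recfun_intros = recfun_const recfun_hd recfun_Suc recfun_add recfun_mult recfun_diff recfun_power
  recfun_div recfun_mod recfun_sum recfun_of_bool recfun_if recpred_const recpred_not recpred_conj recpred_disj
  recpred_le recpred_less recpred_eq recpred_ball recpred_bex

definition rec1 :: "(nat \<Rightarrow> nat) \<Rightarrow> bool" where
  "rec1 f \<longleftrightarrow> recfun (Suc 0) (\<lambda>xs. f (hd xs))"

definition rec2 :: "(nat \<Rightarrow> nat \<Rightarrow> nat) \<Rightarrow> bool" where
  "rec2 f \<longleftrightarrow> recfun (Suc (Suc 0)) (\<lambda>xs. f (hd xs) (hd (tl xs)))"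

definition recpred1 :: "(nat \<Rightarrow> bool) \<Rightarrow> bool" where
  "recpred1 P \<longleftrightarrow> recpred (Suc 0) (\<lambda>xs. P (hd xs))"

definition recpred2 :: "(nat \<Rightarrow> nat \<Rightarrow> bool) \<Rightarrow> bool" where
  "recpred2 P \<longleftrightarrow> recpred (Suc (Suc 0)) (\<lambda>xs. P (hd xs) (hd (tl xs)))"

lemma rec1_comp: "rec1 f \<Longrightarrow> recfun k g \<Longrightarrow> recfun k (\<lambda>xs. f (g xs))"
  using recfun_comp[of "[g]" "\<lambda>xs. f (hd xs)" k] by (simp add: rec1_def)

lemma rec2_comp: "rec2 f \<Longrightarrow> recfun k g \<Longrightarrow> recfun k h \<Longrightarrow> recfun k (\<lambda>xs. f (g xs) (h xs))"
  using recfun_comp[of "[g, h]" "\<lambda>xs. f (hd xs) (hd (tl xs))" k] by (simp add: rec2_def)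

lemma recpred1_comp: "recpred1 P \<Longrightarrow> recfun k g \<Longrightarrow> recpred k (\<lambda>xs. P (g xs))"
  using recfun_comp[of "[g]" "\<lambda>xs. of_bool (P (hd xs))" k] by (simp add: recpred1_def recpred_def)

lemma recpred2_comp:
  "recpred2 P \<Longrightarrow> recfun k g \<Longrightarrow> recfun k h \<Longrightarrow> recpred k (\<lambda>xs. P (g xs) (h xs))"
  using recfun_comp[of "[g, h]" "\<lambda>xs. of_bool (P (hd xs) (hd (tl xs)))" k]
  by (simp add: recpred2_def recpred_def)

lemma total_recursive_iff_rec1: "total_recursive f \<longleftrightarrow> rec1 f"
proof
  assume "total_recursive f"
  then obtain r where r: "\<And>x. eval r [x] (f x)"
    unfolding total_recursive_def partial_recursive_def by blast
  show "rec1 f"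
    unfolding rec1_def recfun_def by (intro exI[of _ r]) (auto simp: length_Suc_conv r)
next
  assume "rec1 f"
  then obtain r where r: "\<And>x. eval r [x] (f x)"
    unfolding rec1_def recfun_def by (metis length_Cons list.sel(1) list.size(3))
  show "total_recursive f"
    unfolding total_recursive_def partial_recursive_def
    by (intro exI[of _ r]) (auto intro: r dest: eval_det[OF r])
qed

section \<open>Stagewise evaluation of partial recursive functions\<close>

text \<open>By monotonicity a maximum of finitely many stages works. This synchronises the
  subcomputations of a composition and of a minimisation.\<close>

lemma uniform_stage:
  fixes n :: nat
  assumes "\<And>i t t'. P i t \<Longrightarrow> t \<le> t' \<Longrightarrow> P i t'" and "\<forall>i<n. \<exists>t. P i t"
  shows "\<exists>t::nat. \<forall>i<n. P i t"
  using assms(2)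
proof (induction n)
  case (Suc n)
  then obtain t t' where "\<forall>i<n. P i t" "P n t'" by auto
  then have "\<forall>i<Suc n. P i (max t t')"
    using assms(1) by (metis less_Suc_eq max.cobounded1 max.cobounded2)
  then show ?case by blast
qed simp

text \<open>\<open>F t xs\<close> is \<open>0\<close> as long as \<open>r\<close> has not converged within \<open>t\<close> stages, and \<open>Suc y\<close> once it has converged to
  \<open>y\<close>. Such an \<open>F\<close> is built by recursion on \<open>r\<close>, so no universal function is needed.\<close>

definition stage_fun :: "nat \<Rightarrow> recf \<Rightarrow> (nat \<Rightarrow> nat list \<Rightarrow> nat) \<Rightarrow> bool" where
  "stage_fun k r F \<longleftrightarrow> recfun (Suc k) (\<lambda>ys. F (hd ys) (tl ys)) \<and>
     (\<forall>t t' xs y. length xs = k \<longrightarrow> F t xs = Suc y \<longrightarrow> t \<le> t' \<longrightarrow> F t' xs = Suc y) \<and>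
     (\<forall>xs y. length xs = k \<longrightarrow> (eval r xs y \<longleftrightarrow> (\<exists>t. F t xs = Suc y)))"

lemma stage_fun_recfun: "stage_fun k r F \<Longrightarrow> recfun (Suc k) (\<lambda>ys. F (hd ys) (tl ys))"
  unfolding stage_fun_def by blast

lemma stage_fun_mono:
  assumes "stage_fun k r F" "length xs = k" "F t xs \<noteq> 0" "t \<le> t'"
  shows "F t' xs = F t xs"
proof -
  obtain y where y: "F t xs = Suc y" using assms(3) not0_implies_Suc by blast
  then have "F t' xs = Suc y" using assms(1,2,4) unfolding stage_fun_def by blast
  with y show ?thesis by simp
qed

lemma stage_fun_eval:
  "stage_fun k r F \<Longrightarrow> length xs = k \<Longrightarrow> eval r xs y \<longleftrightarrow> (\<exists>t. F t xs = Suc y)"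
  unfolding stage_fun_def by blast

lemma recpred_list_all:
  "\<forall>x\<in>set xs. recpred k (P x) \<Longrightarrow> recpred k (\<lambda>ys. \<forall>x\<in>set xs. P x ys)"
proof (induction xs)
  case Nil
  then show ?case by (simp add: recpred_const)
next
  case (Cons a xs)
  then have "recpred k (\<lambda>ys. P a ys \<and> (\<forall>x\<in>set xs. P x ys))"
    by (intro recpred_conj) auto
  then show ?case by simp
qed

text \<open>The outer function is consulted only once all arguments have converged; from then on
  they are frozen, so its result persists. Subtracting 1 strips the convergence mark.\<close>

lemma stage_fun_Comp:
  assumes f: "stage_fun (length gs) f F" and g: "\<And>g. g \<in> set gs \<Longrightarrow> stage_fun k g (G g)"
  shows "stage_fun k (Comp f gs) (\<lambda>t xs. if \<forall>g\<in>set gs. G g t xs \<noteq> 0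
    then F t (map (\<lambda>g. G g t xs - 1) gs) else 0)" (is "stage_fun k _ ?H")
  unfolding stage_fun_def
proof (intro conjI allI impI)
  have "recfun (Suc k) (\<lambda>xs. (\<lambda>ys. F (hd ys) (tl ys))
      (map (\<lambda>f. f xs) ((\<lambda>xs. hd xs) # map (\<lambda>g xs. G g (hd xs) (tl xs) - 1) gs)))"
    using stage_fun_recfun[OF f] stage_fun_recfun[OF g]
    by (intro recfun_comp) (auto intro!: recfun_intros)
  moreover have "(\<lambda>f. f xs) \<circ> (\<lambda>g xs. G g (hd xs) (tl xs) - 1) = (\<lambda>g. G g (hd xs) (tl xs) - 1)" for xs
    by auto
  ultimately have "recfun (Suc k) (\<lambda>xs. F (hd xs) (map (\<lambda>g. G g (hd xs) (tl xs) - 1) gs))"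
    by simp
  then show "recfun (Suc k) (\<lambda>ys. ?H (hd ys) (tl ys))"
    using stage_fun_recfun[OF g] by (intro recfun_if recpred_list_all recfun_const)
      (auto intro!: recpred_less recfun_const)
  have mono: "G g t' xs = G g t xs" if "g \<in> set gs" "G g t xs \<noteq> 0" "t \<le> t'" "length xs = k" for g t t' xs
    using stage_fun_mono[OF g[OF that(1)]] that(2-) by blast
  show "?H t' xs = Suc y" if "length xs = k" "?H t xs = Suc y" "t \<le> t'" for t t' xs y
  proof -
    have nz: "\<forall>g\<in>set gs. G g t xs \<noteq> 0" and F: "F t (map (\<lambda>g. G g t xs - 1) gs) = Suc y"
      using that(2) by (auto split: if_splits)
    have eq: "\<forall>g\<in>set gs. G g t' xs = G g t xs" using mono nz that by blast
    then have "map (\<lambda>g. G g t' xs - 1) gs = map (\<lambda>g. G g t xs - 1) gs" by simp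
    moreover have "F t' (map (\<lambda>g. G g t xs - 1) gs) = Suc y"
      using stage_fun_mono[OF f _ _ that(3)] F by simp
    moreover have "\<forall>g\<in>set gs. G g t' xs \<noteq> 0" using eq nz by simp
    ultimately show ?thesis by (metis (no_types, lifting))
  qed
  show "eval (Comp f gs) xs z \<longleftrightarrow> (\<exists>t. ?H t xs = Suc z)" if xs: "length xs = k" for xs z
  proof
    assume "eval (Comp f gs) xs z"
    then obtain ys where ys: "list_all2 (\<lambda>g y. eval g xs y) gs ys" "eval f ys z"
      by (rule eval_CompE)
    have len: "length ys = length gs" using ys(1) by (simp add: list_all2_lengthD)
    have "\<forall>i<length gs. \<exists>t. G (gs ! i) t xs = Suc (ys ! i)"
      using ys(1) stage_fun_eval[OF g xs] by (auto simp: list_all2_conv_all_nth)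
    then have "\<forall>i<length gs. \<exists>t. i < length gs \<and> G (gs ! i) t xs = Suc (ys ! i)" by blast
    then have "\<exists>t. \<forall>i<length gs. i < length gs \<and> G (gs ! i) t xs = Suc (ys ! i)"
    proof (rule uniform_stage[rotated])
      fix i t t' assume "i < length gs \<and> G (gs ! i) t xs = Suc (ys ! i)" "t \<le> t'"
      then show "i < length gs \<and> G (gs ! i) t' xs = Suc (ys ! i)"
        using mono[of "gs ! i" t xs t'] xs by simp
    qed
    then obtain t1 where t1: "\<forall>i<length gs. G (gs ! i) t1 xs = Suc (ys ! i)" by blast
    obtain t2 where t2: "F t2 ys = Suc z" using stage_fun_eval[OF f len] ys(2) by blast
    let ?t = "max t1 t2"
    have G: "\<forall>i<length gs. G (gs ! i) ?t xs = Suc (ys ! i)"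
      using mono[OF nth_mem _ max.cobounded1 xs] t1 by auto
    then have nz: "\<forall>g\<in>set gs. G g ?t xs \<noteq> 0" by (auto simp: in_set_conv_nth)
    have "map (\<lambda>g. G g ?t xs - 1) gs = ys"
      using G len by (auto intro!: nth_equalityI)
    moreover have "F ?t ys = Suc z"
      using stage_fun_mono[OF f len _ max.cobounded2] t2 by simp
    ultimately show "\<exists>t. ?H t xs = Suc z" using nz by (intro exI[of _ ?t]) simp
  next
    assume "\<exists>t. ?H t xs = Suc z"
    then obtain t where nz: "\<forall>g\<in>set gs. G g t xs \<noteq> 0" and F: "F t (map (\<lambda>g. G g t xs - 1) gs) = Suc z"
      by (auto split: if_splits)
    have "eval f (map (\<lambda>g. G g t xs - 1) gs) z"
      using stage_fun_eval[OF f] F by auto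
    moreover have "eval g xs (G g t xs - 1)" if gm: "g \<in> set gs" for g
      unfolding stage_fun_eval[OF g[OF gm] xs] using nz gm by (intro exI[of _ t]) simp
    ultimately show "eval (Comp f gs) xs z"
      by (intro eval_Comp[of xs gs "map (\<lambda>g. G g t xs - 1) gs"])
        (auto simp: list_all2_conv_all_nth)
  qed
qed

text \<open>The whole recursion runs at one fixed stage, and a 0 for a value not yet available
  propagates upwards. Since values persist, the finitely many steps can all be done at a common
  later stage.\<close>

lemma stage_fun_Prim:
  assumes f: "stage_fun k f F" and g: "stage_fun (Suc (Suc k)) g G"
  shows "stage_fun (Suc k) (Prim f g) (\<lambda>t xs. rec_nat (F t (tl xs))
    (\<lambda>n y. if y = 0 then 0 else G t (n # (y - 1) # tl xs)) (hd xs))"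
  unfolding stage_fun_def
proof (intro conjI allI impI)
  let ?R = "\<lambda>t xs n. rec_nat (F t xs) (\<lambda>n y. if y = 0 then 0 else G t (n # (y - 1) # xs)) n"
  \<comment> \<open>The step sees counter, accumulator, stage, recursion bound and then the
    parameters: four entries are dropped and three are put back in the order that \<open>G\<close>
    expects.\<close>
  have "recfun (length [\<lambda>zs. hd (tl (tl zs)), \<lambda>zs. hd zs, \<lambda>zs. hd (tl zs) - 1] + k) (\<lambda>ys. G (hd ys) (tl ys))"
    using g by (simp add: stage_fun_def)
  from recfun_comp_drop[OF this, of 4]
  have G: "recfun (Suc (Suc (Suc (Suc k)))) (\<lambda>zs. G (hd (tl (tl zs))) (hd zs # (hd (tl zs) - 1) # tl (tl (tl (tl zs)))))"
    by (simp add: recfun_intros drop_Suc eval_nat_numeral)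
  show "recfun (Suc (Suc k)) (\<lambda>ys. ?R (hd ys) (tl (tl ys)) (hd (tl ys)))"
    using f by (intro recfun_rec_nat recfun_intros recfun_drop_snd G) (simp add: stage_fun_def)
  have mono: "?R t' xs n = Suc y" if "length xs = k" "?R t xs n = Suc y" "t \<le> t'" for t t' xs n y
    using that(2)
  proof (induction n arbitrary: y)
    case 0
    then show ?case using stage_fun_mono[OF f that(1) _ that(3)] by simp
  next
    case (Suc n)
    then obtain z where "?R t xs n = Suc z" "G t (n # z # xs) = Suc y"
      by (cases "?R t xs n") auto
    moreover from this have "G t' (n # z # xs) = Suc y"
      using stage_fun_mono[OF g _ _ that(3)] that(1) by simp
    ultimately show ?case using Suc.IH by simp
  qed
  show "?R t' (tl xs) (hd xs) = Suc y"
    if "length xs = Suc k" "?R t (tl xs) (hd xs) = Suc y" "t \<le> t'" for t t' xs y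
    using mono[of "tl xs" t "hd xs" y t'] that by simp
  have ev: "eval (Prim f g) (n # xs) y \<longleftrightarrow> (\<exists>t. ?R t xs n = Suc y)" if xs: "length xs = k" for n xs y
  proof (induction n arbitrary: y)
    case 0
    have "eval (Prim f g) (0 # xs) y \<longleftrightarrow> eval f xs y"
      by (auto intro: eval_Prim0 elim: eval_Prim0E)
    then show ?case using stage_fun_eval[OF f xs] by simp
  next
    case (Suc n)
    have "eval (Prim f g) (Suc n # xs) y \<longleftrightarrow> (\<exists>z. eval (Prim f g) (n # xs) z \<and> eval g (n # z # xs) y)"
      by (auto intro: eval_PrimS elim: eval_PrimSE)
    also have "\<dots> \<longleftrightarrow> (\<exists>z. (\<exists>t. ?R t xs n = Suc z) \<and> (\<exists>t. G t (n # z # xs) = Suc y))"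
      using Suc.IH stage_fun_eval[OF g] xs by simp
    also have "\<dots> \<longleftrightarrow> (\<exists>z t. ?R t xs n = Suc z \<and> G t (n # z # xs) = Suc y)"
    proof
      assume "\<exists>z. (\<exists>t. ?R t xs n = Suc z) \<and> (\<exists>t. G t (n # z # xs) = Suc y)"
      then obtain z t1 t2 where "?R t1 xs n = Suc z" "G t2 (n # z # xs) = Suc y" by blast
      then have "?R (max t1 t2) xs n = Suc z" "G (max t1 t2) (n # z # xs) = Suc y"
        using mono[OF xs _ max.cobounded1] stage_fun_mono[OF g _ _ max.cobounded2] xs by auto
      then show "\<exists>z t. ?R t xs n = Suc z \<and> G t (n # z # xs) = Suc y" by blast
    qed blast
    also have "\<dots> \<longleftrightarrow> (\<exists>t. ?R t xs (Suc n) = Suc y)"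
    proof -
      have "(\<exists>z. ?R t xs n = Suc z \<and> G t (n # z # xs) = Suc y) \<longleftrightarrow> ?R t xs (Suc n) = Suc y" for t
        by (cases "?R t xs n") auto
      then show ?thesis by blast
    qed
    finally show ?case .
  qed
  show "eval (Prim f g) xs y \<longleftrightarrow> (\<exists>t. ?R t (tl xs) (hd xs) = Suc y)" if "length xs = Suc k" for xs y
  proof -
    have "hd xs # tl xs = xs" using that by (cases xs) auto
    then show ?thesis using ev[of "tl xs" "hd xs" y] that by simp
  qed
qed

text \<open>The value 1 means convergence to 0, a value of at least 2 convergence to something
  positive. Hence at most one summand is nonzero, and the sum is \<open>Suc\<close> of the minimum
  once that is confirmed.\<close>

lemma stage_fun_Mu:
  assumes f: "stage_fun (Suc k) f F"
  shows "stage_fun k (Mu f) (\<lambda>t xs. \<Sum>n<t. if F t (n # xs) = 1 \<and> (\<forall>m<n. 2 \<le> F t (m # xs)) then Suc n else 0)"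
    (is "stage_fun k _ ?H")
  unfolding stage_fun_def
proof (intro conjI allI impI)
  let ?Q = "\<lambda>t xs n. F t (n # xs) = 1 \<and> (\<forall>m<n. 2 \<le> F t (m # xs))"
  have "recfun (length [\<lambda>zs. hd (tl zs), \<lambda>zs. hd zs] + k) (\<lambda>ys. F (hd ys) (tl ys))"
    "recfun (length [\<lambda>zs. hd (tl (tl zs)), \<lambda>zs. hd zs] + k) (\<lambda>ys. F (hd ys) (tl ys))"
    using f by (simp_all add: stage_fun_def)
  from recfun_comp_drop[OF this(1), of 2] recfun_comp_drop[OF this(2), of 3]
  have F: "recfun (Suc (Suc k)) (\<lambda>zs. F (hd (tl zs)) (hd zs # tl (tl zs)))"
    "recfun (Suc (Suc (Suc k))) (\<lambda>zs. F (hd (tl (tl zs))) (hd zs # tl (tl (tl zs))))"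
    by (simp_all add: recfun_intros drop_Suc eval_nat_numeral)
  show "recfun (Suc k) (\<lambda>ys. ?H (hd ys) (tl ys))"
    by (intro recfun_intros F)
  have uniq: "n = n'" if "?Q t xs n" "?Q t xs n'" for t xs n n'
  proof (rule ccontr)
    assume "n \<noteq> n'"
    then have "n < n' \<or> n' < n" by auto
    then have "2 \<le> F t (n # xs) \<or> 2 \<le> F t (n' # xs)" using that by blast
    then show False using that by simp
  qed
  have H: "?H t xs = Suc y \<longleftrightarrow> y < t \<and> ?Q t xs y" for t xs y
  proof -
    have *: "?H t xs = Suc n" if "n < t" "?Q t xs n" for n
    proof -
      have "?H t xs = (\<Sum>i\<in>{n}. if ?Q t xs i then Suc i else 0)"
      proof (rule sum.mono_neutral_right)
        show "\<forall>i\<in>{..<t} - {n}. (if ?Q t xs i then Suc i else 0) = 0"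
        proof
          fix i assume "i \<in> {..<t} - {n}"
          then have "\<not> ?Q t xs i" using uniq[OF that(2), of i] by blast
          then show "(if ?Q t xs i then Suc i else 0) = 0" by (rule if_not_P)
        qed
      qed (use that in auto)
      then show ?thesis using that by simp
    qed
    have ex: "\<exists>n<t. ?Q t xs n" if "?H t xs = Suc y"
    proof (rule ccontr)
      assume neg: "\<not> (\<exists>n<t. ?Q t xs n)"
      have "?H t xs = 0"
      proof (rule sum.neutral, rule ballI)
        fix i assume "i \<in> {..<t}"
        then have "\<not> ?Q t xs i" using neg by blast
        then show "(if ?Q t xs i then Suc i else 0) = 0" by (rule if_not_P)
      qed
      then show False using that by simp
    qed
    show ?thesis
    proof
      assume "?H t xs = Suc y"
      moreover from ex[OF this] obtain n where "n < t" "?Q t xs n" by blast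
      moreover from *[OF this] have "?H t xs = Suc n" .
      ultimately show "y < t \<and> ?Q t xs y" by simp
    qed (use * in blast)
  qed
  have mono: "?Q t' xs n" if "length xs = k" "?Q t xs n" "t \<le> t'" for t t' xs n
  proof -
    have eq: "F t' (m # xs) = F t (m # xs)" if "F t (m # xs) \<noteq> 0" for m
      using stage_fun_mono[OF f _ that \<open>t \<le> t'\<close>] \<open>length xs = k\<close> by simp
    have "F t (m # xs) \<noteq> 0" if "m < n" for m using \<open>?Q t xs n\<close> that by force
    then show ?thesis using eq that(2) by simp
  qed
  show "?H t' xs = Suc y" if "length xs = k" "?H t xs = Suc y" "t \<le> t'" for t t' xs y
    using that mono[of xs t y t'] unfolding H by simp
  show "eval (Mu f) xs n \<longleftrightarrow> (\<exists>t. ?H t xs = Suc n)" if xs: "length xs = k" for xs n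
    unfolding H
  proof
    assume "eval (Mu f) xs n"
    then have e: "eval f (n # xs) 0" "\<forall>m<n. \<exists>y. y > 0 \<and> eval f (m # xs) y"
      by (auto elim: eval_MuE)
    have ev: "eval f (m # xs) y \<longleftrightarrow> (\<exists>t. F t (m # xs) = Suc y)" for m y
      using stage_fun_eval[OF f] xs by simp
    have mF: "F t' (m # xs) = F t (m # xs)" if "F t (m # xs) \<noteq> 0" "t \<le> t'" for m t t'
      using stage_fun_mono[OF f _ that] xs by simp
    obtain t1 where t1: "F t1 (n # xs) = 1" using e(1) ev by auto
    have "\<forall>m<n. \<exists>t. 2 \<le> F t (m # xs)"
    proof (intro allI impI)
      fix m assume "m < n"
      then obtain y t where "y > 0" "F t (m # xs) = Suc y" using e(2) unfolding ev by blast
      then show "\<exists>t. 2 \<le> F t (m # xs)" by (intro exI[of _ t]) simp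
    qed
    then have "\<exists>t. \<forall>m<n. 2 \<le> F t (m # xs)"
    proof (rule uniform_stage[rotated])
      fix i t t' assume "2 \<le> F t (i # xs)" "t \<le> t'"
      then show "2 \<le> F t' (i # xs)" using mF[of t i t'] by simp
    qed
    then obtain t2 where t2: "\<forall>m<n. 2 \<le> F t2 (m # xs)" ..
    let ?t = "max (Suc n) (max t1 t2)"
    have "F ?t (n # xs) = 1" using mF[of t1 n ?t] t1 by simp
    moreover have "2 \<le> F ?t (m # xs)" if "m < n" for m
    proof -
      have "2 \<le> F t2 (m # xs)" using t2 that by blast
      then show ?thesis using mF[of t2 m ?t] by simp
    qed
    ultimately show "\<exists>t. n < t \<and> ?Q t xs n" by (intro exI[of _ ?t]) simp
  next
    assume "\<exists>t. n < t \<and> ?Q t xs n"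
    then obtain t where t: "?Q t xs n" by blast
    have ev: "eval f (m # xs) y" if "F t (m # xs) = Suc y" for m y
      using stage_fun_eval[OF f, of "m # xs" y] xs that by auto
    show "eval (Mu f) xs n"
    proof (rule eval_Mu)
      show "eval f (n # xs) 0" using t ev[of n 0] by simp
      show "\<forall>m<n. \<exists>y>0. eval f (m # xs) y"
      proof (intro allI impI)
        fix m assume "m < n"
        then have "2 \<le> F t (m # xs)" using t by blast
        then have "F t (m # xs) = Suc (F t (m # xs) - 1)" "F t (m # xs) - 1 > 0" by auto
        then show "\<exists>y>0. eval f (m # xs) y" using ev by blast
      qed
    qed
  qed
qed

text \<open>Induction on \<open>r\<close> with the arity arbitrary. Where \<open>r\<close> does not
  fit the arity, as for \<open>Succ\<close> or \<open>Prim\<close> without arguments, nothing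
  evaluates and the constant 0 serves.\<close>

lemma stage_fun_exists: "\<exists>F. stage_fun k r F"
proof (induction r arbitrary: k)
  case Zero
  have "stage_fun k Zero (\<lambda>_ _. 1)"
    unfolding stage_fun_def by (auto intro: recfun_const eval_Zero elim: eval_ZeroE)
  then show ?case by blast
next
  case Succ
  show ?case
  proof (cases k)
    case 0
    have "stage_fun k Succ (\<lambda>_ _. 0)"
      unfolding stage_fun_def using 0 by (auto intro: recfun_const elim: eval_SuccE)
    then show ?thesis by blast
  next
    case (Suc k')
    have "stage_fun k Succ (\<lambda>_ xs. Suc (Suc (hd xs)))"
      unfolding stage_fun_def Suc
      by (auto intro!: recfun_intros eval_Succ simp: length_Suc_conv elim!: eval_SuccE)
    then show ?thesis by blast
  qed
next
  case (Proj i)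
  show ?case
  proof (cases "i < k")
    case True
    have "stage_fun k (Proj i) (\<lambda>_ xs. Suc (xs ! i))"
      unfolding stage_fun_def using True
      by (auto intro!: recfun_Suc recfun_tl[OF recfun_nth] elim: eval_ProjE intro: eval_Proj)
    then show ?thesis by blast
  next
    case False
    have "stage_fun k (Proj i) (\<lambda>_ _. 0)"
      unfolding stage_fun_def using False by (auto intro: recfun_const elim: eval_ProjE)
    then show ?thesis by blast
  qed
next
  case (Comp f gs)
  obtain F where F: "stage_fun (length gs) f F" using Comp.IH(1) by blast
  have "\<forall>g\<in>set gs. \<exists>G. stage_fun k g G" using Comp.IH(2) by blast
  then obtain G where "\<And>g. g \<in> set gs \<Longrightarrow> stage_fun k g (G g)" by metis
  from stage_fun_Comp[OF F this] show ?case by blast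
next
  case (Prim f g)
  show ?case
  proof (cases k)
    case 0
    have "stage_fun k (Prim f g) (\<lambda>_ _. 0)"
      unfolding stage_fun_def using 0 by (auto intro: recfun_const elim: eval_PrimE)
    then show ?thesis by blast
  next
    case (Suc k')
    then show ?thesis using stage_fun_Prim Prim.IH by blast
  qed
next
  case (Mu f)
  then show ?case using stage_fun_Mu by blast
qed

section \<open>Machines on strings: numbering, simulation by stages, search\<close>

lemma bij_code_bits: "bij code_bits"
proof (rule bijI)
  show "inj code_bits"
  proof (rule injI)
    fix x y show "code_bits x = code_bits y \<Longrightarrow> x = y"
    proof (induction x arbitrary: y)
      case Nil
      then show ?case by (cases y) (auto split: if_splits)
    next
      case (Cons a x)
      then show ?case by (cases y) (auto split: if_splits; presburger)+
    qed
  qed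
  have "\<exists>p. code_bits p = n" for n
  proof (induction n rule: less_induct)
    case (less n)
    show ?case
    proof (cases "n = 0")
      case True
      then show ?thesis by (intro exI[of _ "[]"]) simp
    next
      case False
      \<comment> \<open>The digits are 1 and 2, so the head bit is given by the parity of
        \<open>n\<close> and the rest of the string has the code
        \<open>(n - 1) div 2\<close>.\<close>
      define m where "m = (n - 1) div 2"
      have "m < n" using False by (simp add: m_def)
      then obtain p where p: "code_bits p = m" using less by blast
      have "code_bits (even n # p) = n" using False p by (simp add: m_def) presburger
      then show ?thesis by blast
    qed
  qed
  then show "surj code_bits" by (metis surjI)
qed

definition decode_bits :: "nat \<Rightarrow> bits" where
  "decode_bits = inv code_bits"

lemma decode_code [simp]: "decode_bits (code_bits p) = p"
  unfolding decode_bits_def by (simp add: bij_code_bits bij_is_inj)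

lemma code_decode [simp]: "code_bits (decode_bits x) = x"
  unfolding decode_bits_def by (simp add: bij_code_bits bij_is_surj surj_f_inv_f)

lemma code_bits_eq_iff [simp]: "code_bits p = code_bits q \<longleftrightarrow> p = q"
  by (metis decode_code)

lemma partial_recursive_bits_iff:
  "partial_recursive_bits C \<longleftrightarrow> (\<exists>r. \<forall>x y. C (decode_bits x) = Some (decode_bits y) \<longleftrightarrow> eval r [x] y)"
proof -
  have "(\<exists>p. code_bits p = x)" "(THE p. code_bits p = x) = decode_bits x" for x
    by (metis code_decode) (metis (mono_tags, lifting) code_decode decode_code the_equality)
  moreover have "map_option code_bits u = Some y \<longleftrightarrow> u = Some (decode_bits y)" for u y
    by (cases u) auto
  ultimately show ?thesis unfolding partial_recursive_bits_def partial_recursive_def by simp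
qed

text \<open>The value 0 stands for a computation still running and \<open>Suc\<close> of a code for
  an output, so that every stage is a total function on codes.\<close>

definition simulates :: "(nat \<Rightarrow> nat \<Rightarrow> nat) \<Rightarrow> (bits \<Rightarrow> bits option) \<Rightarrow> bool" where
  "simulates F C \<longleftrightarrow> rec2 F \<and> (\<forall>t t' x y. F t x = Suc y \<longrightarrow> t \<le> t' \<longrightarrow> F t' x = Suc y) \<and>
     (\<forall>p s. C p = Some s \<longleftrightarrow> (\<exists>t. F t (code_bits p) = Suc (code_bits s)))"

lemma simulatesD:
  assumes "simulates F C"
  shows "rec2 F" "F t x = Suc y \<Longrightarrow> t \<le> t' \<Longrightarrow> F t' x = Suc y"
    "C p = Some s \<longleftrightarrow> (\<exists>t. F t (code_bits p) = Suc (code_bits s))"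
  using assms unfolding simulates_def by blast+

lemma simulation_exists:
  assumes "partial_recursive_bits C"
  shows "\<exists>F. simulates F C"
proof -
  obtain r where r: "\<And>x y. C (decode_bits x) = Some (decode_bits y) \<longleftrightarrow> eval r [x] y"
    using assms unfolding partial_recursive_bits_iff by blast
  obtain F where F: "stage_fun (Suc 0) r F" using stage_fun_exists by blast
  have "recfun (Suc (Suc 0)) (\<lambda>ys. F (hd ys) (tl ys))" using F by (rule stage_fun_recfun)
  then have "rec2 (\<lambda>t x. F t [x])"
    unfolding rec2_def by (rule recfun_cong[rotated]) (auto simp: length_Suc_conv)
  moreover have "F t' [x] = Suc y" if "F t [x] = Suc y" "t \<le> t'" for t t' x y
    using stage_fun_mono[OF F, of "[x]" t t'] that by simp
  moreover have "C p = Some s \<longleftrightarrow> (\<exists>t. F t [code_bits p] = Suc (code_bits s))" for p s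
    using r[of "code_bits p" "code_bits s"] stage_fun_eval[OF F, of "[code_bits p]" "code_bits s"] by simp
  ultimately have "simulates (\<lambda>t x. F t [x]) C" unfolding simulates_def by blast
  then show ?thesis by blast
qed

text \<open>The common shape of the machines constructed below: unbounded search for the first
  witness of a decidable predicate, then a total recursive function of witness and program.\<close>

definition search_machine :: "(nat \<Rightarrow> nat \<Rightarrow> bool) \<Rightarrow> (nat \<Rightarrow> nat \<Rightarrow> nat) \<Rightarrow> bits \<Rightarrow> bits option" where
  "search_machine P g p = (if \<exists>i. P i (code_bits p)
     then Some (decode_bits (g (LEAST i. P i (code_bits p)) (code_bits p))) else None)"

lemma partial_recursive_search_machine:
  assumes "recpred2 P" "rec2 g"
  shows "partial_recursive_bits (search_machine P g)"
proof -
  \<comment> \<open>\<open>Mu\<close> looks for a zero, hence the negation.\<close>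
  have "recfun (Suc (Suc 0)) (\<lambda>xs. of_bool (\<not> P (hd xs) (hd (tl xs))))"
    using assms(1) unfolding recpred2_def by (intro recfun_intros)
  then obtain rP where rP: "\<And>xs. length xs = Suc (Suc 0) \<Longrightarrow> eval rP xs (of_bool (\<not> P (hd xs) (hd (tl xs))))"
    unfolding recfun_def by blast
  obtain rg where rg: "\<And>xs. length xs = Suc (Suc 0) \<Longrightarrow> eval rg xs (g (hd xs) (hd (tl xs)))"
    using assms(2) unfolding rec2_def recfun_def by blast
  have P: "eval rP [i, x] y \<longleftrightarrow> y = of_bool (\<not> P i x)" for i x y
    using rP[of "[i, x]"] eval_det by fastforce
  have mu: "eval (Mu rP) [x] i \<longleftrightarrow> P i x \<and> (\<forall>j<i. \<not> P j x)" for i x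
  proof
    assume "eval (Mu rP) [x] i"
    then show "P i x \<and> (\<forall>j<i. \<not> P j x)" by (rule eval_MuE) (auto simp: P)
  next
    assume "P i x \<and> (\<forall>j<i. \<not> P j x)"
    then show "eval (Mu rP) [x] i" by (intro eval_Mu) (auto simp: P)
  qed
  have g: "eval rg [i, x] y \<longleftrightarrow> y = g i x" for i x y
    using rg[of "[i, x]"] eval_det by fastforce
  have "eval (Comp rg [Mu rP, Proj 0]) [x] y \<longleftrightarrow> (\<exists>i. P i x \<and> (\<forall>j<i. \<not> P j x) \<and> y = g i x)" for x y
  proof
    assume "eval (Comp rg [Mu rP, Proj 0]) [x] y"
    then show "\<exists>i. P i x \<and> (\<forall>j<i. \<not> P j x) \<and> y = g i x"
      by (rule eval_CompE) (auto simp: list_all2_Cons1 mu g elim!: eval_ProjE)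
  next
    assume "\<exists>i. P i x \<and> (\<forall>j<i. \<not> P j x) \<and> y = g i x"
    then obtain i where i: "P i x \<and> (\<forall>j<i. \<not> P j x)" "y = g i x" by blast
    show "eval (Comp rg [Mu rP, Proj 0]) [x] y"
      by (rule eval_Comp[of _ _ "[i, x]"]) (use i eval_Proj[of 0 "[x]"] in \<open>auto simp: mu g\<close>)
  qed
  moreover have "(\<exists>i. Q i \<and> (\<forall>j<i. \<not> Q j) \<and> y = h i) \<longleftrightarrow> (\<exists>i. Q i) \<and> y = h (LEAST i. Q i)"
    for Q :: "nat \<Rightarrow> bool" and h :: "nat \<Rightarrow> nat" and y
  proof -
    have "Q i \<and> (\<forall>j<i. \<not> Q j) \<longleftrightarrow> (\<exists>i. Q i) \<and> i = (LEAST i. Q i)" for i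
      by (metis LeastI_ex Least_le linorder_neqE_nat not_less_Least)
    then show ?thesis by metis
  qed
  moreover have "decode_bits a = decode_bits b \<longleftrightarrow> a = b" for a b by (metis code_decode)
  ultimately show ?thesis
    unfolding partial_recursive_bits_iff search_machine_def
    by (intro exI[of _ "Comp rg [Mu rP, Proj 0]"]) auto
qed

section \<open>Binary strings and the Kraft--Chaitin theorem\<close>

definition code_length :: "nat \<Rightarrow> nat" where
  "code_length x = length (decode_bits x)"

lemma code_length_code [simp]: "code_length (code_bits s) = length s"
  by (simp add: code_length_def)

text \<open>Bijective base two: for the codes x of length n, the numbers x + 1 fill the block from
  2^n to 2^(n + 1) - 1, so the length is the integer part of the binary logarithm of x + 1.\<close>

lemma code_bits_bounds: "2 ^ length p \<le> code_bits p + 1 \<and> code_bits p + 1 < 2 ^ Suc (length p)"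
  by (induction p) auto

lemma code_length_bounds: "2 ^ code_length x \<le> x + 1 \<and> x + 1 < 2 ^ Suc (code_length x)"
  using code_bits_bounds[of "decode_bits x"] by (simp add: code_length_def)

lemma code_length_unique:
  assumes "2 ^ n \<le> x + 1" "x + 1 < 2 ^ Suc n"
  shows "code_length x = n"
proof -
  have "(2::nat) ^ n < 2 ^ Suc (code_length x)" "(2::nat) ^ code_length x < 2 ^ Suc n"
    using assms code_length_bounds[of x] by linarith+
  then have "n < Suc (code_length x)" "code_length x < Suc n"
    by (metis one_less_numeral_iff power_less_imp_less_exp semiring_norm(76))+
  then show ?thesis by simp
qed

lemma less_code_length_iff: "n < code_length x \<longleftrightarrow> 2 ^ Suc n \<le> x + 1"
proof
  assume "n < code_length x"
  then have "(2::nat) ^ Suc n \<le> 2 ^ code_length x" by (intro power_increasing) auto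
  then show "2 ^ Suc n \<le> x + 1" using code_length_bounds[of x] by linarith
next
  assume "2 ^ Suc n \<le> x + 1"
  then have "(2::nat) ^ Suc n < 2 ^ Suc (code_length x)" using code_length_bounds[of x] by linarith
  then show "n < code_length x" by (metis Suc_less_SucD one_less_numeral_iff power_less_imp_less_exp semiring_norm(76))
qed

lemma code_length_le: "code_length x \<le> x"
proof -
  have "code_length x < 2 ^ code_length x" by simp
  then show ?thesis using code_length_bounds[of x] by linarith
qed

lemma rec1_code_length: "rec1 code_length"
proof -
  have "code_length x = (\<Sum>n<x. of_bool (2 ^ Suc n \<le> x + 1))" for x
  proof -
    have "(\<Sum>n<x. of_bool (2 ^ Suc n \<le> x + 1)) = (\<Sum>n<x. of_bool (n < code_length x) :: nat)"
      unfolding less_code_length_iff ..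
    also have "\<dots> = (\<Sum>n<code_length x. 1)"
      by (rule sum.mono_neutral_cong_right) (use code_length_le[of x] in auto)
    finally show ?thesis by simp
  qed
  then show ?thesis unfolding rec1_def by (simp only:) (intro recfun_intros)
qed

text \<open>Most significant bit first, as in \<open>restr\<close>, so that division by a power of
  two takes a prefix. Only the last \<open>n\<close> binary digits of \<open>v\<close> are
  kept.\<close>

primrec bin :: "nat \<Rightarrow> nat \<Rightarrow> bits" where
  "bin 0 v = []"
| "bin (Suc n) v = bin n (v div 2) @ [odd v]"

lemma length_bin [simp]: "length (bin n v) = n"
  by (induction n arbitrary: v) auto

lemma bin_inject:
  "v < 2 ^ n \<Longrightarrow> w < 2 ^ n \<Longrightarrow> bin n v = bin n w \<Longrightarrow> v = w"
proof (induction n arbitrary: v w)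
  case (Suc n)
  then have "v div 2 = w div 2" "odd v = odd w" by auto
  then show ?case by (metis bit_eq_rec even_iff_mod_2_eq_zero)
qed simp

lemma bin_add: "bin (m + j) v = bin m (v div 2 ^ j) @ bin j v"
  by (induction j arbitrary: v) (auto simp: div_mult2_eq)

text \<open>In terms of dyadic intervals, a prefix names an interval that contains the one of the
  longer string.\<close>

lemma bin_prefixD:
  assumes "bin n w = bin m v @ r" "v < 2 ^ m" "w < 2 ^ n"
  shows "m \<le> n \<and> v = w div 2 ^ (n - m)"
proof -
  have mn: "m \<le> n" using arg_cong[OF assms(1), of length] by simp
  then have "bin n w = bin m (w div 2 ^ (n - m)) @ bin (n - m) w"
    using bin_add[of m "n - m" w] by simp
  then have "bin m v = bin m (w div 2 ^ (n - m))" using assms(1) by simp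
  moreover have "w div 2 ^ (n - m) < 2 ^ m"
    using assms(3) mn by (simp add: less_mult_imp_div_less flip: power_add)
  ultimately show ?thesis using bin_inject assms(2) mn by blast
qed

lemma bin_nth: "i < n \<Longrightarrow> bin n v ! i = odd (v div 2 ^ (n - 1 - i))"
proof (induction n arbitrary: v)
  case (Suc n)
  show ?case
  proof (cases "i < n")
    case True
    then have "Suc (n - Suc i) = n - i" by simp
    then have "v div 2 div 2 ^ (n - Suc i) = v div 2 ^ (n - i)"
      by (metis div_mult2_eq power_Suc)
    then show ?thesis using Suc.IH[OF True, of "v div 2"] True by (simp add: nth_append)
  next
    case False
    then show ?thesis using Suc.prems by (simp add: nth_append less_Suc_eq)
  qed
qed simp

text \<open>The recursion over the string becomes a bounded sum over numbers, to which
  \<open>recfun_sum\<close> applies.\<close>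

lemma code_bits_sum: "code_bits p = (\<Sum>i<length p. (1 + of_bool (p ! i)) * 2 ^ i)"
proof (induction p)
  case (Cons b p)
  have "(\<Sum>i<length (b # p). (1 + of_bool ((b # p) ! i)) * 2 ^ i :: nat) =
    (1 + of_bool b) + (\<Sum>i<length p. 2 * ((1 + of_bool (p ! i)) * 2 ^ i))"
    unfolding list.size add_0_right add_Suc_right sum.lessThan_Suc_shift by (simp add: ac_simps)
  then show ?case using Cons by (simp add: sum_distrib_left)
qed simp

lemma rec2_code_bin: "rec2 (\<lambda>n v. code_bits (bin n v))"
proof -
  have "code_bits (bin n v) = (\<Sum>i<n. (1 + (v div 2 ^ (n - 1 - i)) mod 2) * 2 ^ i)" for n v
    unfolding code_bits_sum length_bin
    by (intro sum.cong) (auto simp: bin_nth odd_iff_mod_2_eq_one)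
  then show ?thesis unfolding rec2_def by (simp only:) (intro recfun_intros)
qed

text \<open>Halving under the floor shifts out the last bit, so the bitwise definition collapses to
  the notation of one integer.\<close>

lemma restr_eq_bin: "restr \<alpha> n = bin n (nat \<lfloor>frac \<alpha> * 2 ^ n\<rfloor>)"
proof (induction n)
  case (Suc n)
  have "\<lfloor>frac \<alpha> * 2 ^ Suc n\<rfloor> div 2 = \<lfloor>frac \<alpha> * 2 ^ n\<rfloor>"
    using floor_divide_real_eq_div[of 2 "frac \<alpha> * 2 ^ Suc n"] by simp
  moreover have "0 \<le> \<lfloor>frac \<alpha> * 2 ^ Suc n\<rfloor>" by (simp add: frac_ge_0)
  ultimately have "nat \<lfloor>frac \<alpha> * 2 ^ Suc n\<rfloor> div 2 = nat \<lfloor>frac \<alpha> * 2 ^ n\<rfloor>"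
    "odd (nat \<lfloor>frac \<alpha> * 2 ^ Suc n\<rfloor>) = odd \<lfloor>frac \<alpha> * 2 ^ Suc n\<rfloor>"
    by (auto simp: even_nat_iff nat_div_distrib simp flip: nat_div_distrib)
  then show ?case using Suc by (simp add: restr_def)
qed (simp add: restr_def)

section \<open>Kraft's inequality and complexity bounds\<close>

lemma real_two_power_diff:
  assumes "n \<le> m"
  shows "real (2 ^ (m - n)) = 2 ^ m * (1/2) ^ n"
proof -
  have "(2::real) ^ m = 2 ^ (m - n) * 2 ^ n" using assms by (simp flip: power_add)
  then show ?thesis by (simp add: power_one_over)
qed

text \<open>Extend every element to all strings of the maximal length \<open>N\<close>.
  Prefix-freeness makes the sets of extensions disjoint, and together they have at most 2^N
  elements.\<close>

lemma kraft:
  assumes "finite P" "prefix_free P"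
  shows "(\<Sum>p\<in>P. (1/2) ^ length p) \<le> (1::real)"
proof -
  define N where "N = Max (insert 0 (length ` P))"
  have N: "length p \<le> N" if "p \<in> P" for p
    unfolding N_def using assms(1) that by (intro Max_ge) auto
  define E where "E p = (\<lambda>r. p @ r) ` {r::bits. length r = N - length p}" for p :: bits
  have card_len: "finite {r::bits. length r = n}" "card {r::bits. length r = n} = 2 ^ n" for n
    using finite_lists_length_eq[of "UNIV :: bool set" n] card_lists_length_eq[of "UNIV :: bool set" n] by simp_all
  have cardE: "card (E p) = 2 ^ (N - length p)" "finite (E p)" for p
    unfolding E_def using card_len by (auto simp: card_image inj_on_def)
  have "card (\<Union>p\<in>P. E p) = (\<Sum>p\<in>P. card (E p))"
  proof (rule card_UN_disjoint[OF assms(1)])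
    show "\<forall>p\<in>P. finite (E p)" using cardE by simp
    show "\<forall>p\<in>P. \<forall>q\<in>P. p \<noteq> q \<longrightarrow> E p \<inter> E q = {}"
    proof (intro ballI impI)
      fix p q assume pq: "p \<in> P" "q \<in> P" "p \<noteq> q"
      show "E p \<inter> E q = {}"
      proof (rule ccontr)
        assume "E p \<inter> E q \<noteq> {}"
        then obtain r r' where "p @ r = q @ r'" unfolding E_def by blast
        then have "(\<exists>u. p = q @ u) \<or> (\<exists>u. q = p @ u)" by (auto simp: append_eq_append_conv2)
        then show False using assms(2) pq unfolding prefix_free_def by metis
      qed
    qed
  qed
  moreover have "card (\<Union>p\<in>P. E p) \<le> card {r::bits. length r = N}"
    by (rule card_mono) (use card_len N in \<open>auto simp: E_def\<close>)
  ultimately have "(\<Sum>p\<in>P. 2 ^ (N - length p)) \<le> (2::nat) ^ N"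
    using cardE card_len by simp
  then have "real (\<Sum>p\<in>P. 2 ^ (N - length p)) \<le> real (2 ^ N)" by (rule of_nat_mono)
  moreover have "real (\<Sum>p\<in>P. 2 ^ (N - length p)) = 2 ^ N * (\<Sum>p\<in>P. (1/2) ^ length p)"
    unfolding of_nat_sum sum_distrib_left
    by (intro sum.cong) (simp_all add: N real_two_power_diff del: of_nat_power)
  ultimately show ?thesis by simp
qed

lemma H_C_le: "C p = Some s \<Longrightarrow> H_C C s \<le> enat (length p)"
  unfolding H_C_def by (rule INF_lower) simp

text \<open>A nonempty set of naturals has a least element; only the empty infimum is
  \<infinity>.\<close>

lemma H_C_attained:
  assumes "H_C C s \<noteq> \<infinity>"
  obtains p where "C p = Some s" "H_C C s = enat (length p)"
proof -
  let ?S = "(\<lambda>p. enat (length p)) ` {p. C p = Some s}"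
  have ne: "?S \<noteq> {}"
  proof
    assume e: "?S = {}"
    have "Inf ?S = \<infinity>" unfolding e by (simp add: Inf_enat_def)
    then show False using assms unfolding H_C_def by simp
  qed
  then have "Inf ?S \<in> ?S" unfolding Inf_enat_def by (auto intro: LeastI)
  then show thesis using that unfolding H_C_def by auto
qed

lemma optimal_machine_bound:
  assumes "optimal_machine U" "prefix_free_machine C"
  obtains d where "\<And>p s. C p = Some s \<Longrightarrow> H_C U s \<le> enat (length p + d)"
proof -
  obtain d where d: "\<forall>p\<in>dom C. \<exists>q\<in>dom U. U q = C p \<and> length q \<le> length p + d"
    using assms unfolding optimal_machine_def by blast
  have "H_C U s \<le> enat (length p + d)" if Cp: "C p = Some s" for p s
  proof -
    obtain q where "U q = Some s" "length q \<le> length p + d" using d Cp by (metis domI)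
    then show ?thesis using H_C_le[of U q s] by (meson enat_ord_simps(1) order_trans)
  qed
  then show thesis by (rule that)
qed

text \<open>Effective Kraft--Chaitin theorem in the style of Shannon--Fano--Elias coding: the \<open>i\<close>-th
  active request owns the interval \<open>[c\<^sub>i, c\<^sub>i + 2\<^bsup>-l i\<^esup>)\<close>, where \<open>c\<^sub>i\<close> is the weight of the earlier
  ones, and its program is the first dyadic interval of half that length inside it.\<close>

lemma kraft_chaitin:
  fixes l \<sigma> :: "nat \<Rightarrow> nat"
  assumes act: "recpred1 act" and l: "rec1 l" and \<sigma>: "rec1 \<sigma>"
    and bound: "\<And>n. (\<Sum>i<n. of_bool (act i) * (1/2) ^ l i) \<le> (1::real)"
  obtains C where "prefix_free_machine C"
    "\<And>i. act i \<Longrightarrow> \<exists>p. length p = Suc (l i) \<and> C p = Some (decode_bits (\<sigma> i))"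
proof -
  define c :: "nat \<Rightarrow> real" where "c n = (\<Sum>i<n. of_bool (act i) * (1/2) ^ l i)" for n
  \<comment> \<open>The lengths of all earlier requests are at most \<open>D i\<close>, so
    \<open>2 ^ D i\<close> is a common denominator and \<open>c i\<close> equals
    \<open>N i / 2 ^ D i\<close>.\<close>
  define D where "D i = (\<Sum>j<i. l j)" for i
  define N where "N i = (\<Sum>j<i. of_bool (act j) * 2 ^ (D i - l j) :: nat)" for i
  \<comment> \<open>The ceiling of \<open>c i * 2 ^ Suc (l i)\<close>. Rounding up costs less than
    one unit of half the owned length, so the unit starting there stays inside the owned
    interval.\<close>
  define v where "v i = (N i * 2 ^ Suc (l i) + 2 ^ D i - 1) div 2 ^ D i" for i
  define prog where "prog i = bin (Suc (l i)) (v i)" for i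
  have D: "rec1 D" unfolding D_def rec1_def by (intro recfun_intros rec1_comp[OF l])
  have N: "rec1 N" unfolding N_def rec1_def
    by (intro recfun_intros recpred1_comp[OF act] rec1_comp[OF l] rec1_comp[OF D])
  have v: "rec1 v" unfolding v_def rec1_def
    by (intro recfun_intros rec1_comp[OF N] rec1_comp[OF l] rec1_comp[OF D])
  have P: "recpred2 (\<lambda>i x. act i \<and> x = code_bits (prog i))"
    unfolding prog_def recpred2_def
    by (intro recfun_intros recpred1_comp[OF act] rec2_comp[OF rec2_code_bin] rec1_comp[OF l] rec1_comp[OF v])
  have g: "rec2 (\<lambda>i x. \<sigma> i)" unfolding rec2_def by (intro rec1_comp[OF \<sigma>] recfun_intros)
  define C where "C = search_machine (\<lambda>i x. act i \<and> x = code_bits (prog i)) (\<lambda>i x. \<sigma> i)"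
  have Nc: "real (N i) = c i * 2 ^ D i" for i
  proof -
    have "l j \<le> D i" if "j < i" for j
      unfolding D_def by (rule member_le_sum) (use that in auto)
    then show ?thesis
      unfolding N_def c_def of_nat_sum sum_distrib_right
      by (intro sum.cong) (simp_all add: real_two_power_diff del: of_nat_power)
  qed
  have v_ge: "c i * 2 ^ Suc (l i) \<le> real (v i)" and v_lt: "real (v i) < c i * 2 ^ Suc (l i) + 1" for i
  proof -
    let ?a = "N i * 2 ^ Suc (l i)" and ?b = "2 ^ D i :: nat"
    have "?a + ?b - 1 = v i * ?b + (?a + ?b - 1) mod ?b" unfolding v_def by (rule div_mult_mod_eq[symmetric])
    moreover have "(?a + ?b - 1) mod ?b < ?b" by simp
    ultimately have nat: "?a \<le> v i * ?b" "v i * ?b < ?a + ?b"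
      using zero_less_power[of "2::nat" "D i"] by linarith+
    have "real ?a \<le> real (v i * ?b)" "real (v i * ?b) < real (?a + ?b)"
      using nat by (simp_all only: of_nat_le_iff of_nat_less_iff)
    then have "(c i * 2 ^ Suc (l i)) * 2 ^ D i \<le> real (v i) * 2 ^ D i"
      "real (v i) * 2 ^ D i < (c i * 2 ^ Suc (l i) + 1) * 2 ^ D i"
      using Nc[of i] by (simp_all add: algebra_simps)
    then show "c i * 2 ^ Suc (l i) \<le> real (v i)" "real (v i) < c i * 2 ^ Suc (l i) + 1"
      by (simp_all only: mult_le_cancel_right_pos mult_less_cancel_right_pos zero_less_power zero_less_numeral)
  qed
  have c_Suc: "c (Suc i) = c i + (1/2) ^ l i" if "act i" for i
    using that by (simp add: c_def)
  have c_mono: "c i \<le> c j" if "i \<le> j" for i j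
    unfolding c_def by (rule sum_mono2) (use that in auto)
  have c_le: "c i \<le> 1" for i using bound unfolding c_def .
  have v_lt': "real (v i) + 1 < c (Suc i) * 2 ^ Suc (l i)" if "act i" for i
    using v_lt[of i] c_Suc[OF that] by (simp add: algebra_simps power_one_over)
  have v_bound: "v i < 2 ^ Suc (l i)" if "act i" for i
  proof -
    have "c (Suc i) * 2 ^ Suc (l i) \<le> 1 * 2 ^ Suc (l i)" by (intro mult_right_mono c_le) simp
    then have "real (v i) < 1 * 2 ^ Suc (l i)" using v_lt'[OF that] by linarith
    then have "real (v i) < real (2 ^ Suc (l i))" by simp
    then show ?thesis by (simp only: of_nat_less_iff)
  qed
  \<comment> \<open>A prefix would place the interval of one program inside that of another, but
    different active requests own disjoint intervals.\<close>
  have pf: "i = j" if a: "act i" "act j" and pre: "prog j = prog i @ r" for i j r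
  proof -
    let ?m = "Suc (l i)" and ?n = "Suc (l j)"
    have "?m \<le> ?n \<and> v i = v j div 2 ^ (?n - ?m)"
      using bin_prefixD[of ?n "v j" ?m "v i" r] pre v_bound a unfolding prog_def by blast
    then have mn: "?m \<le> ?n" and vi: "v i = v j div 2 ^ (?n - ?m)" by auto
    have "v i * 2 ^ (?n - ?m) \<le> v j" "v j < (v i + 1) * 2 ^ (?n - ?m)"
      using vi by (simp_all add: div_times_less_eq_dividend dividend_less_div_times)
    then have "real (v i * 2 ^ (?n - ?m)) \<le> real (v j)" "real (v j) < real ((v i + 1) * 2 ^ (?n - ?m))"
      by (simp_all only: of_nat_le_iff of_nat_less_iff)
    moreover have "(2::real) ^ ?n = 2 ^ ?m * 2 ^ (?n - ?m)" using mn by (simp flip: power_add)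
    ultimately have x: "real (v i) / 2 ^ ?m \<le> real (v j) / 2 ^ ?n" "real (v j) / 2 ^ ?n < (real (v i) + 1) / 2 ^ ?m"
      by (simp_all add: field_simps)
    have lo: "c k \<le> real (v k) / 2 ^ Suc (l k)" for k
      using v_ge[of k] by (simp add: field_simps)
    have hi: "(real (v k) + 1) / 2 ^ Suc (l k) < c (Suc k)" if "act k" for k
      using v_lt'[OF that] by (simp add: field_simps)
    show ?thesis
    proof (rule linorder_cases[of i j])
      assume "i < j"
      then show ?thesis using c_mono[of "Suc i" j] lo[of j] hi[OF a(1)] x(2) by linarith
    next
      assume "j < i"
      moreover have "real (v j) / 2 ^ ?n \<le> (real (v j) + 1) / 2 ^ ?n" by (simp add: divide_right_mono)
      ultimately show ?thesis using c_mono[of "Suc j" i] lo[of i] hi[OF a(2)] x(1) by linarith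
    qed
  qed
  have C: "C p = Some s \<Longrightarrow> \<exists>i. act i \<and> p = prog i" for p s
    unfolding C_def search_machine_def by (auto split: if_splits)
  have "prefix_free (dom C)"
    unfolding prefix_free_def
  proof (intro ballI impI)
    fix p q assume "p \<in> dom C" "q \<in> dom C" "\<exists>r. q = p @ r"
    then show "p = q" using C pf by (metis domD)
  qed
  moreover have "partial_recursive_bits C"
    unfolding C_def by (rule partial_recursive_search_machine[OF P g])
  ultimately have "prefix_free_machine C" unfolding prefix_free_machine_def by blast
  moreover have "\<exists>p. length p = Suc (l i) \<and> C p = Some (decode_bits (\<sigma> i))" if "act i" for i
  proof (intro exI conjI)
    show "length (prog i) = Suc (l i)" by (simp add: prog_def)
    \<comment> \<open>With \<open>r = []\<close>, \<open>pf\<close> makes the programs of different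
      active requests distinct, so the search finds the request \<open>i\<close> itself.\<close>
    have "(LEAST j. act j \<and> code_bits (prog i) = code_bits (prog j)) = i"
    proof (rule Least_equality)
      fix j assume "act j \<and> code_bits (prog i) = code_bits (prog j)"
      then show "i \<le> j" using pf[of j i "[]"] that by simp
    qed (use that in simp)
    then show "C (prog i) = Some (decode_bits (\<sigma> i))"
      using that unfolding C_def search_machine_def by auto
  qed
  ultimately show thesis by (rule that)
qed

text \<open>Lengthening all requests by \<open>k\<close> with \<open>K < 2 ^ k\<close> scales their
  weight below 1, and optimality of \<open>U\<close> turns the resulting machine into a bound with
  one additive constant.\<close>

lemma optimal_machine_requests:
  fixes l \<sigma> :: "nat \<Rightarrow> nat" and K :: real
  assumes U: "optimal_machine U" and act: "recpred1 act" and l: "rec1 l" and \<sigma>: "rec1 \<sigma>"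
    and bound: "\<And>n. (\<Sum>i<n. of_bool (act i) * (1/2) ^ l i) \<le> K"
  obtains d where "\<And>i. act i \<Longrightarrow> H_C U (decode_bits (\<sigma> i)) \<le> enat (l i + d)"
proof -
  obtain k where k: "K < 2 ^ k" using real_arch_pow[of 2 K] by auto
  have l': "rec1 (\<lambda>i. l i + k)" using l unfolding rec1_def by (intro recfun_intros)
  have "(\<Sum>i<n. of_bool (act i) * (1/2) ^ (l i + k)) \<le> (1::real)" for n
  proof -
    have "(\<Sum>i<n. of_bool (act i) * (1/2) ^ (l i + k)) = (\<Sum>i<n. of_bool (act i) * (1/2) ^ l i) * (1/2 :: real) ^ k"
      by (simp add: sum_distrib_right power_add mult.assoc)
    also have "\<dots> \<le> 2 ^ k * (1/2 :: real) ^ k"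
      using bound[of n] k by (intro mult_right_mono) auto
    finally show ?thesis by (simp flip: power_mult_distrib)
  qed
  from kraft_chaitin[OF act l' \<sigma> this] obtain C where C: "prefix_free_machine C"
    "\<And>i. act i \<Longrightarrow> \<exists>p. length p = Suc (l i + k) \<and> C p = Some (decode_bits (\<sigma> i))" by metis
  obtain d where d: "\<And>p s. C p = Some s \<Longrightarrow> H_C U s \<le> enat (length p + d)"
    using optimal_machine_bound[OF U C(1)] by blast
  have "H_C U (decode_bits (\<sigma> i)) \<le> enat (l i + (Suc k + d))" if i: "act i" for i
  proof -
    obtain p where "length p = Suc (l i + k)" "C p = Some (decode_bits (\<sigma> i))" using C(2)[OF i] by blast
    then show ?thesis using d[of p] by (simp add: add.assoc)
  qed
  then show thesis by (rule that)
qed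

section \<open>The weight of the compressible strings\<close>

text \<open>The index set of the series \<open>Theta_bar V T\<close>.\<close>

definition compressible :: "(bits \<Rightarrow> bits option) \<Rightarrow> real \<Rightarrow> bits set" where
  "compressible V T = {s. ereal_of_enat (H_C V s) < ereal (T * real (length s))}"

text \<open>A finite infimum of lengths is attained, so a single program witnesses membership. This
  makes the set enumerable when \<open>T\<close> can be approximated from below.\<close>

lemma compressible_iff:
  "s \<in> compressible V T \<longleftrightarrow> (\<exists>p. V p = Some s \<and> real (length p) < T * real (length s))"
proof
  assume s: "s \<in> compressible V T"
  then have "H_C V s \<noteq> \<infinity>" by (intro notI) (simp add: compressible_def)
  then obtain p where "V p = Some s" "H_C V s = enat (length p)" by (rule H_C_attained)
  with s show "\<exists>p. V p = Some s \<and> real (length p) < T * real (length s)"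
    by (auto simp: compressible_def)
next
  assume "\<exists>p. V p = Some s \<and> real (length p) < T * real (length s)"
  then obtain p where p: "V p = Some s" "real (length p) < T * real (length s)" by blast
  have "ereal_of_enat (H_C V s) \<le> ereal_of_enat (enat (length p))"
    using H_C_le[of V p s, OF p(1)] by (simp only: ereal_of_enat_le_iff)
  also have "\<dots> < ereal (T * real (length s))" using p(2) by simp
  finally show "s \<in> compressible V T" by (simp add: compressible_def)
qed

text \<open>\<open>i \<mapsto> (code_length i, i + 1 - 2 ^ code_length i)\<close> is an enumeration of the pairs \<open>(t, n)\<close> with
  \<open>n < 2 ^ t\<close>.\<close>

lemma sum_code_pairs:
  fixes f :: "nat \<Rightarrow> nat \<Rightarrow> real"
  shows "(\<Sum>i<2 ^ N - 1. f (code_length i) (i + 1 - 2 ^ code_length i)) = (\<Sum>t<N. \<Sum>n<2 ^ t. f t n)"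
proof (induction N)
  case (Suc N)
  have "code_length i = N" if "i \<in> {2 ^ N - 1..<2 ^ Suc N - 1}" for i
    by (rule code_length_unique) (use that in auto)
  then have "(\<Sum>i\<in>{2 ^ N - 1..<2 ^ Suc N - 1}. f (code_length i) (i + 1 - 2 ^ code_length i)) =
    (\<Sum>i\<in>{2 ^ N - 1..<2 ^ Suc N - 1}. f N (i + 1 - 2 ^ N))"
    by (intro sum.cong refl) simp
  also have "\<dots> = (\<Sum>n<2 ^ N. f N n)"
    by (rule sum.reindex_bij_witness[of _ "\<lambda>n. n + (2 ^ N - 1)" "\<lambda>i. i + 1 - 2 ^ N"]) auto
  finally have "(\<Sum>i\<in>{2 ^ N - 1..<2 ^ Suc N - 1}. f (code_length i) (i + 1 - 2 ^ code_length i)) =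
    (\<Sum>n<2 ^ N. f N n)" .
  moreover have "(\<Sum>i<2 ^ Suc N - 1. f (code_length i) (i + 1 - 2 ^ code_length i)) =
      (\<Sum>i<2 ^ N - 1. f (code_length i) (i + 1 - 2 ^ code_length i)) +
      (\<Sum>i\<in>{2 ^ N - 1..<2 ^ Suc N - 1}. f (code_length i) (i + 1 - 2 ^ code_length i))"
    unfolding lessThan_atLeast0 by (rule sum.atLeastLessThan_concat[symmetric]) auto
  ultimately show ?case using Suc by simp
qed simp

lemma sum_code_length:
  fixes f :: "nat \<Rightarrow> real"
  shows "(\<Sum>x<2 ^ N - 1. f (code_length x)) = (\<Sum>j<N. 2 ^ j * f j)"
  using sum_code_pairs[of "\<lambda>t _. f t"] by simp

section \<open>Divergence of the series above slope 1\<close>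

lemma powr_power_real: "((1/2::real) powr x) ^ n = (1/2) powr (x * real n)"
proof -
  have "((1/2::real) powr x) ^ n = ((1/2) powr x) powr real n"
    by (rule powr_realpow[symmetric]) simp
  then show ?thesis by (simp only: powr_powr)
qed

lemma geometric_sum_le:
  fixes \<rho> :: real
  assumes "0 \<le> \<rho>" "\<rho> < 1"
  shows "(\<Sum>j<n. \<rho> ^ j) \<le> 1 / (1 - \<rho>)"
proof -
  have "(\<Sum>j<n. \<rho> ^ j) = (1 - \<rho> ^ n) / (1 - \<rho>)" using assms by (simp add: sum_gp_strict)
  also have "\<dots> \<le> 1 / (1 - \<rho>)" by (rule divide_right_mono) (use assms in auto)
  finally show ?thesis .
qed

lemma le_two_power_minus_one: "n \<le> 2 ^ n - (1::nat)"
  using less_exp[of n] by linarith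

text \<open>Choose \<open>m\<close> with 1 + 1/m < T and request for each string s a program of
  length |s| + |s| div m. Level j then weighs 2^-(j div m), which is summable, so H_V(s) is at most
  (1 + 1/m)|s| + d and thus below T|s| for long s. Every large length contributes 1 to the
  series.\<close>

lemma Theta_bar_infinite:
  assumes V: "optimal_machine V" and T: "1 < T"
  shows "Theta_bar V T = \<infinity>"
proof -
  obtain m0 where m0: "1 / (T - 1) < real m0" using reals_Archimedean2 by blast
  define m where "m = Suc m0"
  have m: "m > 0" "1 / real m < T - 1"
    using m0 T by (auto simp: m_def field_simps)
  define l where "l x = code_length x + code_length x div m" for x
  have l: "rec1 l" unfolding l_def rec1_def by (intro recfun_intros rec1_comp[OF rec1_code_length])
  have act: "recpred1 (\<lambda>_. True)" unfolding recpred1_def by (rule recpred_const)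
  have \<sigma>: "rec1 (\<lambda>x. x)" unfolding rec1_def by (rule recfun_hd)
  define \<rho> where "\<rho> = (1/2::real) powr (1 / real m)"
  have \<rho>: "0 \<le> \<rho>" "\<rho> < 1"
  proof -
    show "0 \<le> \<rho>" by (simp add: \<rho>_def)
    have "(1/2::real) powr (1 / real m) < (1/2) powr 0"
      by (rule powr_less_mono') (use m in auto)
    then show "\<rho> < 1" by (simp add: \<rho>_def)
  qed
  \<comment> \<open>The factor 2 pays for the rounding in \<open>j div m\<close>.\<close>
  have pow_le: "(1/2::real) ^ (j div m) \<le> 2 * \<rho> ^ j" for j
  proof -
    have "real j / real m \<le> real (j div m) + 1"
    proof -
      have "j < m * (j div m + 1)" using dividend_less_times_div[of m j] m(1) by simp
      then have "real j < real (m * (j div m + 1))" by (simp only: of_nat_less_iff)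
      then show ?thesis using m(1) by (simp add: field_simps)
    qed
    then have "(1/2::real) powr (real (j div m) + 1) \<le> (1/2) powr (real j / real m)"
      by (intro powr_mono') auto
    also have "\<dots> = \<rho> ^ j"
      unfolding \<rho>_def powr_power_real by simp
    finally show ?thesis by (simp add: powr_add powr_realpow)
  qed
  have bound: "(\<Sum>i<n. of_bool True * (1/2) ^ l i) \<le> 2 / (1 - \<rho>)" for n
  proof -
    have "(\<Sum>i<n. of_bool True * (1/2) ^ l i) \<le> (\<Sum>i<2 ^ n - 1. (1/2::real) ^ l i)"
      unfolding of_bool_eq mult_1 by (rule sum_mono2) (use le_two_power_minus_one[of n] in auto)
    also have "\<dots> = (\<Sum>j<n. 2 ^ j * (1/2) ^ (j + j div m))"
      unfolding l_def by (rule sum_code_length)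
    also have "\<dots> = (\<Sum>j<n. (1/2) ^ (j div m))"
      by (intro sum.cong) (auto simp: power_add power_one_over)
    also have "\<dots> \<le> (\<Sum>j<n. 2 * \<rho> ^ j)" by (intro sum_mono pow_le)
    also have "\<dots> \<le> 2 * (1 / (1 - \<rho>))"
      unfolding sum_distrib_left[symmetric] by (intro mult_left_mono geometric_sum_le \<rho>) simp
    finally show ?thesis by simp
  qed
  obtain d where d: "\<And>i. H_C V (decode_bits i) \<le> enat (l i + d)"
    using optimal_machine_requests[OF V act l \<sigma> bound] by metis
  define \<epsilon> where "\<epsilon> = T - 1 - 1 / real m"
  have \<epsilon>: "\<epsilon> > 0" using m by (simp add: \<epsilon>_def)
  obtain n0 where n0: "real d / \<epsilon> < real n0" using reals_Archimedean2 by blast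
  have comp: "decode_bits x \<in> compressible V T" if "n0 \<le> code_length x" for x
  proof -
    let ?n = "real (code_length x)"
    have "real (code_length x div m) \<le> ?n / real m" 
    proof -
      have "real (code_length x div m * m) \<le> ?n" by (simp only: of_nat_le_iff div_times_less_eq_dividend)
      then show ?thesis using m(1) by (simp add: field_simps)
    qed
    moreover have "real d < \<epsilon> * ?n"
    proof -
      have "real d < \<epsilon> * real n0" using n0 \<epsilon> by (simp add: field_simps)
      also have "\<dots> \<le> \<epsilon> * ?n" using that \<epsilon> by simp
      finally show ?thesis .
    qed
    ultimately have "real (l x + d) < T * ?n"
      by (simp add: l_def \<epsilon>_def algebra_simps)
    have "ereal_of_enat (H_C V (decode_bits x)) \<le> ereal_of_enat (enat (l x + d))"
      using d[of x] by (simp only: ereal_of_enat_le_iff)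
    also have "\<dots> < ereal (T * ?n)" using \<open>real (l x + d) < T * ?n\<close> by simp
    finally show ?thesis by (simp add: compressible_def code_length_def)
  qed
  let ?f = "\<lambda>s::bits. ennreal ((1/2) ^ length s)"
  have large: "ennreal (real K) \<le> Theta_bar V T" for K
  proof -
    \<comment> \<open>The strings of \<open>K\<close> consecutive lengths; each length has total
      weight 1.\<close>
    define X where "X = {x. x < 2 ^ (n0 + K) - 1 \<and> n0 \<le> code_length x}"
    have "(\<Sum>x\<in>X. (1/2) ^ code_length x) = (\<Sum>x<2 ^ (n0 + K) - 1. (if n0 \<le> code_length x then (1/2) ^ code_length x else (0::real)))"
      unfolding X_def by (rule sum.mono_neutral_cong_left) auto
    also have "\<dots> = (\<Sum>j<n0 + K. 2 ^ j * (if n0 \<le> j then (1/2) ^ j else 0))"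
      by (rule sum_code_length)
    also have "\<dots> = (\<Sum>j\<in>{n0..<n0 + K}. 1)"
      by (rule sum.mono_neutral_cong_right) (auto simp: power_one_over)
    finally have eq: "(\<Sum>x\<in>X. (1/2) ^ code_length x) = real K" by simp
    have "sum ?f (decode_bits ` X) = (\<Sum>x\<in>X. ennreal ((1/2) ^ code_length x))"
      by (subst sum.reindex) (auto simp: code_length_def inj_on_def dest: arg_cong[of _ _ code_bits])
    also have "\<dots> = ennreal (real K)" unfolding eq[symmetric] by (rule sum_ennreal) simp
    finally have "ennreal (real K) = sum ?f (decode_bits ` X)" ..
    also have "\<dots> \<le> (SUP F\<in>{F. finite F \<and> F \<subseteq> compressible V T}. sum ?f F)"
      by (rule SUP_upper) (use comp in \<open>auto simp: X_def\<close>)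
    also have "\<dots> = Theta_bar V T"
      unfolding Theta_bar_def compressible_def by (rule nonneg_infsum_complete[symmetric]) simp
    finally show ?thesis .
  qed
  show ?thesis
  proof (rule ccontr)
    assume "Theta_bar V T \<noteq> \<infinity>"
    then obtain r where r: "r \<ge> 0" "Theta_bar V T = ennreal r" by (cases "Theta_bar V T") auto
    obtain K where "r < real K" using reals_Archimedean2 by blast
    then show False using large[of K] r by (simp add: ennreal_le_iff)
  qed
qed

text \<open>Each member s has a \<open>V\<close>-program p with |p| < T|s|; different members have
  different programs, so Kraft bounds the sum of 2^-|p|. Each 2^-|p| dominates 2^(-T|s|), and for T
  \<le> 1 integrality gives |p| + 1 \<le> |s|, whence the factor 1/2.\<close>

lemma compressible_weight:
  assumes V: "prefix_free (dom V)" and F: "finite F" "F \<subseteq> compressible V T"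
  shows "(\<Sum>s\<in>F. ((1/2) powr T) ^ length s) \<le> (1::real)"
    and "T \<le> 1 \<Longrightarrow> (\<Sum>s\<in>F. (1/2) ^ length s) \<le> (1/2::real)"
proof -
  have "\<forall>s\<in>F. \<exists>p. V p = Some s \<and> real (length p) < T * real (length s)"
    using F(2) compressible_iff by blast
  then obtain p where p: "\<And>s. s \<in> F \<Longrightarrow> V (p s) = Some s"
    "\<And>s. s \<in> F \<Longrightarrow> real (length (p s)) < T * real (length s)" by metis
  have inj: "inj_on p F" by (rule inj_onI) (metis option.inject p(1))
  have "p ` F \<subseteq> dom V" using p(1) by blast
  with V have "prefix_free (p ` F)"
    unfolding prefix_free_def by (metis subsetD)
  then have kr: "(\<Sum>s\<in>F. (1/2) ^ length (p s)) \<le> (1::real)"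
    using kraft[of "p ` F"] F(1) inj by (simp add: sum.reindex)
  have "((1/2) powr T) ^ length s \<le> (1/2::real) ^ length (p s)" if "s \<in> F" for s
  proof -
    have "((1/2::real) powr T) ^ length s = (1/2) powr (T * real (length s))"
      by (rule powr_power_real)
    also have "\<dots> \<le> (1/2) powr (real (length (p s)))"
      using p(2)[OF that] by (intro powr_mono') auto
    finally show ?thesis by (simp add: powr_realpow)
  qed
  then show "(\<Sum>s\<in>F. ((1/2) powr T) ^ length s) \<le> (1::real)"
    using kr by (meson order_trans sum_mono)
  show "(\<Sum>s\<in>F. (1/2) ^ length s) \<le> (1/2::real)" if T: "T \<le> 1"
  proof -
    have "(1/2::real) ^ length s \<le> (1/2) * (1/2) ^ length (p s)" if "s \<in> F" for s
    proof -
      have "T * real (length s) \<le> real (length s)" using mult_right_mono[OF T, of "real (length s)"] by simp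
      then have "Suc (length (p s)) \<le> length s" using p(2)[OF that] by linarith
      then have "(1/2::real) ^ length s \<le> (1/2) ^ Suc (length (p s))" by (intro power_decreasing) auto
      then show ?thesis by simp
    qed
    then have "(\<Sum>s\<in>F. (1/2::real) ^ length s) \<le> (\<Sum>s\<in>F. (1/2) * (1/2) ^ length (p s))"
      by (rule sum_mono)
    also have "\<dots> \<le> 1/2" unfolding sum_distrib_left[symmetric] using kr by simp
    finally show ?thesis .
  qed
qed

text \<open>The bound on finite partial sums gives convergence in the reals. That 1/2 is strictly
  below 1 is used later: the limit is its own fractional part, and not all strings of one length can
  be members.\<close>

lemma Theta_bar_finite:
  assumes V: "prefix_free (dom V)" and T: "T \<le> 1"
  defines "f \<equiv> \<lambda>s::bits. (1/2::real) ^ length s"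
  shows "f summable_on compressible V T" "Theta_bar V T = ennreal (infsum f (compressible V T))"
    "infsum f (compressible V T) \<le> 1/2" "0 \<le> infsum f (compressible V T)"
proof -
  let ?A = "compressible V T"
  have le: "sum f F \<le> 1/2" if "finite F" "F \<subseteq> ?A" for F
    unfolding f_def using compressible_weight(2)[OF V that T] .
  show s: "f summable_on ?A"
    by (rule nonneg_bdd_above_summable_on) (auto simp: f_def intro!: bdd_aboveI2 le[unfolded f_def])
  show "infsum f ?A \<le> 1/2" by (rule infsum_le_finite_sums[OF s le])
  show "0 \<le> infsum f ?A" by (rule infsum_nonneg) (simp add: f_def)
  have "Theta_bar V T = (SUP F\<in>{F. finite F \<and> F \<subseteq> ?A}. sum (\<lambda>s. ennreal (f s)) F)"
    unfolding Theta_bar_def compressible_def f_def by (rule nonneg_infsum_complete) simp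
  also have "\<dots> = (SUP F\<in>{F. finite F \<and> F \<subseteq> ?A}. ennreal (sum f F))"
    by (simp add: f_def sum_ennreal)
  also have "\<dots> = ennreal (infsum f ?A)"
    by (rule infsum_nonneg_is_SUPREMUM_ennreal[symmetric, OF s]) (simp add: f_def)
  finally show "Theta_bar V T = ennreal (infsum f ?A)" .
qed

section \<open>Approximating the weight by recursive stages\<close>

definition approx_from_below :: "(nat \<Rightarrow> nat) \<Rightarrow> (nat \<Rightarrow> nat) \<Rightarrow> real \<Rightarrow> bool" where
  "approx_from_below a b T \<longleftrightarrow> rec1 a \<and> rec1 b \<and> (\<forall>k. real (a k) / real (b k + 1) \<le> T) \<and>
     (\<forall>x<T. \<exists>k. x < real (a k) / real (b k + 1))"

text \<open>Negating upper approximations of -T gives lower ones of T, and negative ones may be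
  raised to 0 because T > 0. The index shift skips the entry 0, for which no bound is
  assumed.\<close>

lemma left_computable_approx:
  assumes "left_computable T" "0 < T"
  obtains a b where "approx_from_below a b T"
proof -
  obtain f where f: "recursive_rat_seq f" "\<And>n. n \<ge> 1 \<Longrightarrow> - T \<le> of_rat (f n)" "(\<lambda>n. real_of_rat (f n)) \<longlonglongrightarrow> - T"
    using assms(1) unfolding left_computable_def right_computable_def by blast
  obtain sg num den where r: "rec1 sg" "rec1 num" "rec1 den"
    "\<And>n. f n = (if sg n = 0 then 1 else -1) * of_nat (num n) / of_nat (den n + 1)"
    using f(1) unfolding recursive_rat_seq_def total_recursive_iff_rec1 by blast
  define a where "a k = (if sg (Suc k) = 0 then 0 else num (Suc k))" for k
  define b where "b k = den (Suc k)" for k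
  have ab: "real (a k) / real (b k + 1) = max 0 (- of_rat (f (Suc k)))" for k
    by (simp add: a_def b_def r(4) of_rat_divide of_rat_minus of_rat_add max_absorb1 max_absorb2)
  have "rec1 a" "rec1 b"
    unfolding a_def b_def rec1_def
    by (intro recfun_intros rec1_comp[OF r(1)] rec1_comp[OF r(2)] rec1_comp[OF r(3)])+
  moreover have "real (a k) / real (b k + 1) \<le> T" for k
    unfolding ab using f(2)[of "Suc k"] assms(2) by simp
  moreover have "\<exists>k. x < real (a k) / real (b k + 1)" if "x < T" for x
  proof -
    have "(\<lambda>k. real_of_rat (f (Suc k))) \<longlonglongrightarrow> - T" using f(3) by (rule LIMSEQ_Suc)
    then have "eventually (\<lambda>k. real_of_rat (f (Suc k)) < - x) sequentially"
      by (rule order_tendstoD) (use that in simp)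
    then obtain k where "real_of_rat (f (Suc k)) < - x" by (auto simp: eventually_sequentially)
    then show ?thesis unfolding ab by (intro exI[of _ k]) auto
  qed
  ultimately show thesis using that unfolding approx_from_below_def by blast
qed

text \<open>Subtracting the error bound 1/(k + 1) turns the approximation with index k + 1 into a
  lower bound; truncated subtraction cuts negative values off at 0.\<close>

lemma computable_approx:
  assumes "computable_real T" "0 < T"
  obtains a b where "approx_from_below a b T"
proof -
  obtain f where f: "recursive_rat_seq f" "\<And>n. n \<ge> 1 \<Longrightarrow> \<bar>T - of_rat (f n)\<bar> < 1 / real n"
    using assms(1) unfolding computable_real_def by blast
  obtain sg num den where r: "rec1 sg" "rec1 num" "rec1 den"
    "\<And>n. f n = (if sg n = 0 then 1 else -1) * of_nat (num n) / of_nat (den n + 1)"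
    using f(1) unfolding recursive_rat_seq_def total_recursive_iff_rec1 by blast
  define a where "a k = (if sg (Suc k) = 0 then num (Suc k) * Suc k - (den (Suc k) + 1) else 0)" for k
  define b where "b k = (den (Suc k) + 1) * Suc k - 1" for k
  have ab: "real (a k) / real (b k + 1) = max 0 (of_rat (f (Suc k)) - 1 / real (Suc k))" for k
  proof -
    let ?d = "real (den (Suc k) + 1)" and ?k = "real (Suc k)"
    have "b k + 1 = (den (Suc k) + 1) * Suc k" by (simp add: b_def)
    then have b: "real (b k + 1) = ?d * ?k" by (simp only: of_nat_mult)
    have a: "real (a k) = (if sg (Suc k) = 0 then max 0 (real (num (Suc k)) * ?k - ?d) else 0)"
    proof -
      have "real (m - n) = max 0 (real m - real n)" for m n by (simp add: max_def of_nat_diff)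
      from this[of "num (Suc k) * Suc k" "den (Suc k) + 1"] show ?thesis
        unfolding a_def by (cases "sg (Suc k) = 0") (simp_all only: simp_thms if_True if_False of_nat_mult of_nat_0)
    qed
    have q: "real_of_rat (f (Suc k)) = (if sg (Suc k) = 0 then 1 else -1) * real (num (Suc k)) / ?d"
      by (simp add: r(4) of_rat_divide of_rat_minus of_rat_add)
    have pos: "?d > 0" "?k > 0" by simp_all
    show ?thesis
    proof (cases "sg (Suc k) = 0")
      case True
      have "real (num (Suc k)) / ?d - 1 / ?k = (real (num (Suc k)) * ?k - ?d) / (?d * ?k)"
        using pos by (simp add: divide_simps)
      moreover have "max 0 x / y = max 0 (x / y)" if "y > 0" for x y :: real
        using that by (simp add: max_def zero_le_divide_iff)
      ultimately show ?thesis unfolding a b q using True pos by (simp only: simp_thms if_True mult_1 mult_pos_pos)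
    next
      case False
      have "0 \<le> real (num (Suc k)) / ?d" "0 \<le> 1 / ?k" by simp_all
      then have "(- 1) * real (num (Suc k)) / ?d - 1 / ?k \<le> 0" by linarith
      then show ?thesis unfolding a b q using False by (simp only: simp_thms if_False max_absorb1 div_0)
    qed
  qed
  have "rec1 a" "rec1 b"
    unfolding a_def b_def rec1_def
    by (intro recfun_intros rec1_comp[OF r(1)] rec1_comp[OF r(2)] rec1_comp[OF r(3)])+
  moreover have "real (a k) / real (b k + 1) \<le> T" for k
    unfolding ab using f(2)[of "Suc k"] assms(2) by auto
  moreover have "\<exists>k. x < real (a k) / real (b k + 1)" if "x < T" for x
  proof -
    obtain k where k: "2 / (T - x) < real k" using reals_Archimedean2 by blast
    then have "2 / real (Suc k) < T - x" using that by (simp add: field_simps)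
    then have "x < of_rat (f (Suc k)) - 1 / real (Suc k)"
      using f(2)[of "Suc k"] by (simp add: abs_less_iff field_simps del: of_nat_Suc) 
    then show ?thesis unfolding ab by (intro exI[of _ k]) linarith
  qed
  ultimately show thesis using that unfolding approx_from_below_def by blast
qed

text \<open>An enumeration of codes in growing decidable stages. Members of stage t satisfy
  code_length x \<le> x < t, so 2^t is a common denominator of the weight of that stage.\<close>

locale enumerated_sum =
  fixes E :: "nat \<Rightarrow> nat \<Rightarrow> bool" and \<theta> :: real
  assumes rec_E: "recpred2 E"
    and mono_E: "E t x \<Longrightarrow> t \<le> t' \<Longrightarrow> E t' x"
    and lt_E: "E t x \<Longrightarrow> x < t"
    and lim_E: "(\<lambda>t. \<Sum>x | E t x. (1/2) ^ code_length x) \<longlonglongrightarrow> \<theta>"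
begin

lemma finite_E: "finite {x. E t x}"
proof (rule finite_subset)
  show "{x. E t x} \<subseteq> {..<t}" using lt_E by blast
qed simp

definition partial :: "nat \<Rightarrow> real" where
  "partial t = (\<Sum>x | E t x. (1/2) ^ code_length x)"

definition numerator :: "nat \<Rightarrow> nat" where
  "numerator t = (\<Sum>x<t. of_bool (E t x) * 2 ^ (t - code_length x))"

lemma rec1_numerator: "rec1 numerator"
  unfolding numerator_def rec1_def
  by (intro recfun_intros recpred2_comp[OF rec_E] rec1_comp[OF rec1_code_length])

lemma numerator_eq: "real (numerator t) = partial t * 2 ^ t"
proof -
  have "partial t = (\<Sum>x<t. of_bool (E t x) * (1/2) ^ code_length x)"
    unfolding partial_def by (rule sum.mono_neutral_cong_left) (auto dest: lt_E)
  moreover have "real (of_bool (E t x) * 2 ^ (t - code_length x)) = of_bool (E t x) * (1/2) ^ code_length x * 2 ^ t"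
    if "x \<in> {..<t}" for x
  proof -
    have "code_length x \<le> t" using code_length_le[of x] that by simp
    from real_two_power_diff[OF this] show ?thesis by simp
  qed
  ultimately show ?thesis
    unfolding numerator_def of_nat_sum by (simp add: sum_distrib_right)
qed

lemma partial_mono:
  assumes "t \<le> t'"
  shows "partial t \<le> partial t'"
  unfolding partial_def by (rule sum_mono2[OF finite_E]) (use mono_E[OF _ assms] in auto)

lemma partial_tendsto: "partial \<longlonglongrightarrow> \<theta>"
  using lim_E unfolding partial_def .

lemma partial_le: "partial t \<le> \<theta>"
proof (rule incseq_le[OF _ partial_tendsto])
  show "incseq partial" unfolding incseq_def using partial_mono by blast
qed

text \<open>The weight of \<open>x\<close> is absent at stage \<open>t\<close> and present at stage
  \<open>max t t'\<close>. So a stage close to the limit rules out the later arrival of short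
  strings.\<close>

lemma partial_add_le:
  assumes "E t' x" "\<not> E t x"
  shows "partial t + (1/2) ^ code_length x \<le> \<theta>"
proof -
  have "partial t + (1/2) ^ code_length x = (\<Sum>x\<in>insert x {x. E t x}. (1/2) ^ code_length x)"
    using assms(2) finite_E by (simp add: partial_def)
  also have "\<dots> \<le> partial (max t t')"
    unfolding partial_def
    by (rule sum_mono2[OF finite_E]) (use assms(1) mono_E[OF _ max.cobounded1] mono_E[OF _ max.cobounded2] in auto)
  also have "\<dots> \<le> \<theta>" by (rule partial_le)
  finally show ?thesis .
qed

lemma left_computable_sum: "left_computable \<theta>"
proof -
  \<comment> \<open>The constant sign 1 encodes a minus sign in \<open>recursive_rat_seq\<close>,
    and \<open>2 ^ n - 1\<close> is its denominator function; the value is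
    \<open>- partial n\<close>.\<close>
  define f :: "nat \<Rightarrow> rat" where "f n = (if (1::nat) = 0 then 1 else -1) * of_nat (numerator n) / of_nat ((2 ^ n - 1) + 1)" for n
  have f: "of_rat (f n) = - partial n" for n
    by (simp add: f_def of_rat_divide of_rat_minus of_rat_power of_nat_diff numerator_eq)
  have "rec1 (\<lambda>n. 1)" "rec1 (\<lambda>n. 2 ^ n - 1)" unfolding rec1_def by (intro recfun_intros)+
  then have "recursive_rat_seq f"
    unfolding recursive_rat_seq_def total_recursive_iff_rec1 f_def using rec1_numerator by blast
  moreover have "(\<lambda>n. real_of_rat (f n)) \<longlonglongrightarrow> - \<theta>"
    unfolding f by (intro tendsto_minus partial_tendsto)
  ultimately show ?thesis
    unfolding left_computable_def right_computable_def using f partial_le by (metis neg_le_iff_le)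
qed

end

text \<open>Dovetailing over programs, stages and rational lower bounds of \<open>T\<close>
  enumerates the members. Every finite set of members is complete at some stage, so the weights of
  the stages increase to the full sum.\<close>

lemma Theta_bar_enumerated:
  assumes V: "prefix_free_machine V" and T: "T \<le> 1" and approx: "approx_from_below a b T"
  obtains E where "enumerated_sum E (enn2real (Theta_bar V T))"
    "\<And>x. (\<exists>t. E t x) \<longleftrightarrow> decode_bits x \<in> compressible V T"
proof -
  have pf: "prefix_free (dom V)" and pr: "partial_recursive_bits V"
    using V by (auto simp: prefix_free_machine_def)
  obtain F where "simulates F V" using simulation_exists[OF pr] by blast
  note F = simulatesD[OF this]
  have ab: "rec1 a" "rec1 b" "\<And>k. real (a k) / real (b k + 1) \<le> T"
    "\<And>x. x < T \<Longrightarrow> \<exists>k. x < real (a k) / real (b k + 1)"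
    using approx unfolding approx_from_below_def by blast+
  \<comment> \<open>The inequality |p| < (a k / (b k + 1)) |x| is cleared of denominators;
    \<open>t\<close> bounds the element, the program, the index of the approximation and the running
    time alike.\<close>
  define E where "E t x \<longleftrightarrow> x < t \<and> (\<exists>p<t. \<exists>k<t. F t p = Suc x \<and>
    code_length p * (b k + 1) < a k * code_length x)" for t x
  have rec: "recpred2 E"
    unfolding E_def recpred2_def
    by (intro recfun_intros rec2_comp[OF F(1)] rec1_comp[OF rec1_code_length] rec1_comp[OF ab(1)] rec1_comp[OF ab(2)])
  have mono: "E t' x" if E: "E t x" and le: "t \<le> t'" for t t' x
  proof -
    obtain p k where "x < t" "p < t" "k < t" "F t p = Suc x" "code_length p * (b k + 1) < a k * code_length x"
      using E unfolding E_def by blast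
    moreover have "F t' p = Suc x" using F(2)[of t p x t'] le calculation by blast
    ultimately show ?thesis using le unfolding E_def
      by (intro conjI exI[of _ p] exI[of _ k]) auto
  qed
  have lt: "x < t" if "E t x" for t x using that unfolding E_def by blast
  have ex: "(\<exists>t. E t x) \<longleftrightarrow> decode_bits x \<in> compressible V T" for x
  proof
    assume "\<exists>t. E t x"
    then obtain t p k where E: "F t p = Suc x" "code_length p * (b k + 1) < a k * code_length x"
      unfolding E_def by blast
    have "V (decode_bits p) = Some (decode_bits x)"
      unfolding F(3) using E(1) by auto
    moreover have "real (code_length p) < T * real (code_length x)"
    proof -
      have "real (code_length p * (b k + 1)) < real (a k * code_length x)" using E(2) by (simp only: of_nat_less_iff)
      then have "real (code_length p) < real (a k) / real (b k + 1) * real (code_length x)"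
        by (simp add: field_simps)
      also have "\<dots> \<le> T * real (code_length x)" by (intro mult_right_mono ab(3)) simp
      finally show ?thesis .
    qed
    ultimately show "decode_bits x \<in> compressible V T"
      unfolding compressible_iff code_length_def by blast
  next
    assume "decode_bits x \<in> compressible V T"
    then obtain p where p: "V p = Some (decode_bits x)" "real (length p) < T * real (code_length x)"
      unfolding compressible_iff code_length_def by blast
    obtain t where t: "F t (code_bits p) = Suc x" using p(1) unfolding F(3) by auto
    have pos: "real (code_length x) > 0"
      using p(2) by (cases "code_length x = 0") auto
    then have "real (length p) / real (code_length x) < T" using p(2) by (simp add: field_simps)
    then obtain k where "real (length p) / real (code_length x) < real (a k) / real (b k + 1)"
      using ab(4) by blast
    then have "real (length p * (b k + 1)) < real (a k * code_length x)"
      using pos by (simp add: field_simps)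
    then have k: "length p * (b k + 1) < a k * code_length x" by (simp only: of_nat_less_iff)
    let ?t = "Suc (max t (max x (max (code_bits p) k)))"
    have "F ?t (code_bits p) = Suc x" by (rule F(2)[OF t]) simp
    then have "E ?t x" unfolding E_def using k
      by (intro conjI exI[of _ "code_bits p"] exI[of _ k]) auto
    then show "\<exists>t. E t x" by blast
  qed
  let ?f = "\<lambda>s::bits. (1/2::real) ^ length s" and ?A = "compressible V T"
  have \<theta>: "enn2real (Theta_bar V T) = infsum ?f ?A"
    by (simp only: Theta_bar_finite(2)[OF pf T] enn2real_ennreal[OF Theta_bar_finite(4)[OF pf T]])
  have fin: "finite {x. E t x}" for t
  proof (rule finite_subset)
    show "{x. E t x} \<subseteq> {..<t}" using lt by blast
  qed simp
  have inj: "inj decode_bits" by (metis code_decode injI)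
  have sum: "(\<Sum>x | E t x. (1/2::real) ^ code_length x) = sum ?f (decode_bits ` {x. E t x})" for t
    by (subst sum.reindex[OF inj_on_subset[OF inj]]) (simp_all add: code_length_def)
  have lim: "(\<lambda>t. \<Sum>x | E t x. (1/2) ^ code_length x) \<longlonglongrightarrow> infsum ?f ?A"
    unfolding sum
  proof (rule increasing_tendsto)
    show "\<forall>\<^sub>F t in sequentially. sum ?f (decode_bits ` {x. E t x}) \<le> infsum ?f ?A"
    proof (intro always_eventually allI)
      fix t
      have "decode_bits ` {x. E t x} \<subseteq> ?A" using ex by blast
      then show "sum ?f (decode_bits ` {x. E t x}) \<le> infsum ?f ?A"
        using finite_imageI[OF fin] by (intro finite_sum_le_infsum[OF Theta_bar_finite(1)[OF pf T]]) simp_all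
    qed
    fix y assume "y < infsum ?f ?A"
    have "\<exists>F. finite F \<and> F \<subseteq> ?A \<and> y < sum ?f F"
    proof (rule ccontr)
      assume neg: "\<not> (\<exists>F. finite F \<and> F \<subseteq> ?A \<and> y < sum ?f F)"
      have "infsum ?f ?A \<le> y"
      proof (rule infsum_le_finite_sums[OF Theta_bar_finite(1)[OF pf T]])
        fix F :: "bits set" assume "finite F" "F \<subseteq> ?A"
        then have "\<not> y < sum ?f F" using neg by blast
        then show "sum ?f F \<le> y" by (simp only: not_less)
      qed
      then show False using \<open>y < infsum ?f ?A\<close> by simp
    qed
    then obtain F where F: "finite F" "F \<subseteq> ?A" "y < sum ?f F" by blast
    have "\<forall>s\<in>F. \<exists>t. E t (code_bits s)" using F(2) ex by (metis decode_code subsetD)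
    then obtain g where g: "\<And>s. s \<in> F \<Longrightarrow> E (g s) (code_bits s)" by metis
    \<comment> \<open>Any common bound of the finitely many stages serves; the sum also covers the
      empty set.\<close>
    define t0 where "t0 = sum g F"
    have t0: "g s \<le> t0" if "s \<in> F" for s
      unfolding t0_def by (rule member_le_sum) (use that F(1) in auto)
    have "y < sum ?f (decode_bits ` {x. E t x})" if "t0 \<le> t" for t
    proof -
      have "F \<subseteq> decode_bits ` {x. E t x}"
      proof
        fix s assume "s \<in> F"
        then have "E t (code_bits s)" using mono[OF g, of s t] t0[of s] that by simp
        then show "s \<in> decode_bits ` {x. E t x}" by (intro image_eqI[of _ _ "code_bits s"]) simp_all
      qed
      then have "sum ?f F \<le> sum ?f (decode_bits ` {x. E t x})"
        using fin by (intro sum_mono2) auto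
      then show ?thesis using F(3) by simp
    qed
    then show "\<forall>\<^sub>F t in sequentially. y < sum ?f (decode_bits ` {x. E t x})"
      by (auto simp: eventually_sequentially)
  qed
  have "enumerated_sum E (enn2real (Theta_bar V T))"
    unfolding \<theta> by (rule enumerated_sum.intro) (rule rec, erule (1) mono, erule lt, rule lim)
  then show thesis using ex that by blast
qed

section \<open>Randomness\<close>

lemma prefix_free_subset: "prefix_free B \<Longrightarrow> A \<subseteq> B \<Longrightarrow> prefix_free A"
  unfolding prefix_free_def by (meson subsetD)

text \<open>The sum counts the \<open>m\<close> below the least solution, so it equals that
  solution. Least search below a known bound thereby becomes a total recursive function.\<close>

lemma bounded_least_sum:
  assumes "j < b" "P j"
  shows "P (\<Sum>m<b. of_bool (\<forall>j<Suc m. \<not> P j))"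
proof -
  let ?l = "LEAST j. P j"
  have l: "P ?l" "?l \<le> j" using assms(2) by (auto intro: LeastI Least_le)
  have eq: "(\<forall>j<Suc m. \<not> P j) \<longleftrightarrow> m < ?l" for m
  proof
    assume "\<forall>j<Suc m. \<not> P j"
    then have "\<not> ?l < Suc m" using l(1) by blast
    then show "m < ?l" by simp
  next
    assume m: "m < ?l"
    show "\<forall>j<Suc m. \<not> P j"
    proof (intro allI impI)
      fix j assume "j < Suc m"
      then have "j < ?l" using m by simp
      then show "\<not> P j" by (rule not_less_Least)
    qed
  qed
  have "(\<Sum>m<b. of_bool (\<forall>j<Suc m. \<not> P j)) = (\<Sum>m<b. of_bool (m < ?l) :: nat)"
    by (simp only: eq)
  also have "\<dots> = (\<Sum>m<?l. 1)"
    by (rule sum.mono_neutral_cong_right) (use l(2) assms(1) in auto)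
  finally show ?thesis using l(1) by simp
qed

text \<open>The machine \<open>C\<close> runs \<open>U\<close> on p, reads the output as n bits with
  value v, waits for a stage with \<open>v < partial t * 2 ^ n + 1\<close> and prints the first
  string of length n - 1 not enumerated by then. Its domain lies in that of \<open>U\<close>, hence
  it is prefix-free, and the printed string has \<open>V\<close>-complexity at most |p| + d.\<close>

lemma (in enumerated_sum) weakly_random:
  assumes U: "optimal_machine U" and V: "optimal_machine V" and T: "0 < T" "T \<le> 1"
    and ex: "\<And>x. (\<exists>t. E t x) \<longleftrightarrow> decode_bits x \<in> compressible V T"
    and \<theta>: "0 \<le> \<theta>" "\<theta> \<le> 1/2"
  shows "weakly_chaitin_random U T \<theta>"
proof -
  have "partial_recursive_bits U" and pfU: "prefix_free (dom U)"
    using U by (auto simp: optimal_machine_def prefix_free_machine_def)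
  then obtain F where "simulates F U" using simulation_exists by blast
  note F = simulatesD[OF this]
  \<comment> \<open>Codes of length n - 1 lie below 2^n, so this bounded search suffices.\<close>
  define first where "first t n = (\<Sum>m<2 ^ n. of_bool (\<forall>j<Suc m. \<not> (code_length j = n - 1 \<and> \<not> E t j)) :: nat)" for t n
  have first: "rec2 first"
    unfolding first_def rec2_def
    by (intro recfun_intros recpred2_comp[OF rec_E] rec1_comp[OF rec1_code_length])
  \<comment> \<open>The value \<open>v\<close> is recovered from the output of \<open>U\<close> by
    bounded search, and the waiting condition is multiplied by \<open>2 ^ t\<close> to stay within
    the naturals.\<close>
  define P where "P t p \<longleftrightarrow> F t p \<noteq> 0 \<and> (\<exists>v<2 ^ code_length (F t p - 1).
    code_bits (bin (code_length (F t p - 1)) v) = F t p - 1 \<and>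
    v * 2 ^ t < numerator t * 2 ^ code_length (F t p - 1) + 2 ^ t)" for t p
  have P: "recpred2 P"
    unfolding P_def recpred2_def
    by (intro recfun_intros rec2_comp[OF F(1)] rec1_comp[OF rec1_code_length] rec1_comp[OF rec1_numerator]
        rec2_comp[OF rec2_code_bin])
  define g where "g t p = first t (code_length (F t p - 1))" for t p
  have g: "rec2 g"
    unfolding g_def rec2_def
    by (intro recfun_intros rec2_comp[OF F(1)] rec1_comp[OF rec1_code_length] rec2_comp[OF first])
  define C where "C = search_machine P g"
  have F_U: "U p = Some (decode_bits (F t (code_bits p) - 1))" if "F t (code_bits p) \<noteq> 0" for t p
  proof -
    have "F t (code_bits p) = Suc (code_bits (decode_bits (F t (code_bits p) - 1)))" using that by simp
    then show ?thesis unfolding F(3) by blast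
  qed
  have "dom C \<subseteq> dom U"
  proof
    fix p assume "p \<in> dom C"
    then obtain t where "P t (code_bits p)" unfolding C_def search_machine_def by (auto split: if_splits)
    then have "F t (code_bits p) \<noteq> 0" unfolding P_def by blast
    then show "p \<in> dom U" using F_U by blast
  qed
  then have "prefix_free_machine C"
    unfolding prefix_free_machine_def C_def
    using prefix_free_subset[OF pfU] partial_recursive_search_machine[OF P g] by blast
  then obtain d where d: "\<And>p s. C p = Some s \<Longrightarrow> H_C V s \<le> enat (length p + d)"
    using optimal_machine_bound[OF V] by blast
  have frac: "frac \<theta> = \<theta>" using \<theta> by (simp add: frac_eq)
  \<comment> \<open>The extra 1 pays for the lost bit: T n = T (n - 1) + T with T \<le> 1.\<close>
  have "ereal (T * real n - real (d + 1)) \<le> ereal_of_enat (H_C U (restr \<theta> n))" if n: "n \<ge> 1" for n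
  proof (cases "H_C U (restr \<theta> n) = \<infinity>")
    case True
    then show ?thesis by simp
  next
    case False
    then obtain p where p: "U p = Some (restr \<theta> n)" "H_C U (restr \<theta> n) = enat (length p)"
      by (rule H_C_attained)
    define v where "v = nat \<lfloor>\<theta> * 2 ^ n\<rfloor>"
    have v: "real v \<le> \<theta> * 2 ^ n" "\<theta> * 2 ^ n < real v + 1"
      using \<theta>(1) unfolding v_def by (simp_all add: of_nat_floor)
    have "\<theta> * 2 ^ n < 1 * 2 ^ n" using \<theta>(2) by (intro mult_strict_right_mono) auto
    then have "real v < 1 * 2 ^ n" using v(1) by linarith
    then have "real v < real (2 ^ n)" by simp
    then have v_lt: "v < 2 ^ n" by (simp only: of_nat_less_iff)
    have r: "restr \<theta> n = bin n v" unfolding restr_eq_bin frac v_def ..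
    let ?w = "code_bits (bin n v)"
    obtain t0 where t0: "F t0 (code_bits p) = Suc ?w" using p(1) unfolding F(3) r by blast
    \<comment> \<open>This makes the wait end: once \<open>partial t\<close> is within 2^-n of
      \<theta>, the value v \<le> \<theta> 2^n is less than one unit above
      \<open>partial t * 2 ^ n\<close>.\<close>
    have "eventually (\<lambda>t. \<theta> - (1/2) ^ n < partial t) sequentially"
      using partial_tendsto by (rule order_tendstoD) simp
    then obtain t1 where t1: "\<And>t. t \<ge> t1 \<Longrightarrow> \<theta> - (1/2) ^ n < partial t"
      unfolding eventually_sequentially by blast
    have cond: "v * 2 ^ t < numerator t * 2 ^ n + 2 ^ t \<longleftrightarrow> real v < partial t * 2 ^ n + 1" for t
    proof -
      have "v * 2 ^ t < numerator t * 2 ^ n + 2 ^ t \<longleftrightarrow> real (v * 2 ^ t) < real (numerator t * 2 ^ n + 2 ^ t)"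
        by (simp only: of_nat_less_iff)
      also have "\<dots> \<longleftrightarrow> real v * 2 ^ t < (partial t * 2 ^ n + 1) * 2 ^ t"
        by (simp add: numerator_eq algebra_simps)
      also have "\<dots> \<longleftrightarrow> real v < partial t * 2 ^ n + 1" by simp
      finally show ?thesis .
    qed
    have P_iff: "P t (code_bits p) \<longleftrightarrow> F t (code_bits p) = Suc ?w \<and> real v < partial t * 2 ^ n + 1" for t
    proof (cases "F t (code_bits p) = 0")
      case True
      then show ?thesis by (simp add: P_def)
    next
      case False
      then have "decode_bits (F t (code_bits p) - 1) = bin n v" using F_U[of t p] p(1) r by simp
      then have w: "F t (code_bits p) - 1 = ?w" by (metis code_decode)
      have "(\<exists>v'<2 ^ n. code_bits (bin n v') = ?w \<and> v' * 2 ^ t < numerator t * 2 ^ n + 2 ^ t)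
        \<longleftrightarrow> v * 2 ^ t < numerator t * 2 ^ n + 2 ^ t"
      proof
        assume "\<exists>v'<2 ^ n. code_bits (bin n v') = ?w \<and> v' * 2 ^ t < numerator t * 2 ^ n + 2 ^ t"
        then obtain v' where v': "v' < 2 ^ n" "bin n v' = bin n v" "v' * 2 ^ t < numerator t * 2 ^ n + 2 ^ t"
          by auto
        moreover from bin_inject[OF v'(1) v_lt v'(2)] have "v' = v" .
        ultimately show "v * 2 ^ t < numerator t * 2 ^ n + 2 ^ t" by simp
      qed (use v_lt in blast)
      then have "P t (code_bits p) \<longleftrightarrow> v * 2 ^ t < numerator t * 2 ^ n + 2 ^ t"
        unfolding P_def w code_length_code length_bin using False by blast
      moreover have "F t (code_bits p) = Suc ?w" using w False by simp
      ultimately show ?thesis using cond by blast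
    qed
    have "P (max t0 t1) (code_bits p)"
    proof -
      have "\<theta> * 2 ^ n - 1 < partial (max t0 t1) * 2 ^ n"
      proof -
        have "(\<theta> - (1/2) ^ n) * 2 ^ n < partial (max t0 t1) * 2 ^ n"
          by (intro mult_strict_right_mono t1) auto
        then show ?thesis by (simp add: algebra_simps power_one_over)
      qed
      then have "real v < partial (max t0 t1) * 2 ^ n + 1" using v(1) by linarith
      moreover have "F (max t0 t1) (code_bits p) = Suc ?w" by (rule F(2)[OF t0]) simp
      ultimately show ?thesis unfolding P_iff by blast
    qed
    then have exP: "\<exists>t. P t (code_bits p)" by blast
    define t where "t = (LEAST t. P t (code_bits p))"
    have "P t (code_bits p)" unfolding t_def using exP by (rule LeastI_ex)
    then have t: "F t (code_bits p) = Suc ?w" "real v < partial t * 2 ^ n + 1"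
      unfolding P_iff by auto
    define x where "x = first t n"
    have gx: "g t (code_bits p) = x" unfolding g_def x_def t(1) by simp
    have Cp: "C p = Some (decode_bits x)"
      unfolding C_def search_machine_def using exP gx by (simp add: t_def)
    let ?J = "{2 ^ (n - 1) - 1..<2 ^ n - (1::nat)}"
    have two_n: "(2::nat) ^ n = 2 * 2 ^ (n - 1)" using n by (cases n) auto
    have J: "code_length j = n - 1" if "j \<in> ?J" for j
      by (rule code_length_unique) (use that two_n in auto)
    \<comment> \<open>A completely enumerated length would weigh 1, more than \<theta>.\<close>
    have "\<exists>j\<in>?J. \<not> E t j"
    proof (rule ccontr)
      assume "\<not> (\<exists>j\<in>?J. \<not> E t j)"
      then have sub: "?J \<subseteq> {j. E t j}" by blast
      have "(\<Sum>j\<in>?J. (1/2::real) ^ code_length j) = (\<Sum>j\<in>?J. (1/2) ^ (n - 1))"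
        by (intro sum.cong refl) (simp only: J)
      also have "\<dots> = real (card ?J) * (1/2) ^ (n - 1)" by simp
      also have "card ?J = 2 ^ (n - 1)" using two_n by simp
      also have "real (2 ^ (n - 1)) * (1/2) ^ (n - 1) = (1::real)" by (simp add: power_one_over)
      finally have "1 \<le> partial t"
        unfolding partial_def using sum_mono2[OF finite_E sub, of "\<lambda>j. (1/2::real) ^ code_length j"] by simp
      then show False using partial_le[of t] \<theta>(2) by linarith
    qed
    then obtain j where j: "j \<in> ?J" "\<not> E t j" by blast
    have "code_length (first t n) = n - 1 \<and> \<not> E t (first t n)"
      unfolding first_def by (rule bounded_least_sum[of j]) (use j J[OF j(1)] in auto)
    then have x: "code_length x = n - 1" "\<not> E t x" unfolding x_def by auto
    \<comment> \<open>A string of length n - 1 weighs two units of 2^-n, but \<theta> 2^n < v + 1 <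
      \<open>partial t * 2 ^ n + 2\<close> leaves less than that.\<close>
    have "\<not> E t' x" for t'
    proof
      assume "E t' x"
      from partial_add_le[OF this x(2)] have "(partial t + (1/2) ^ (n - 1)) * 2 ^ n \<le> \<theta> * 2 ^ n"
        unfolding x(1) by (intro mult_right_mono) auto
      moreover have "(1/2::real) ^ (n - 1) * 2 ^ n = 2" using n by (cases n) (auto simp: power_one_over)
      ultimately have "partial t * 2 ^ n + 2 \<le> \<theta> * 2 ^ n" by (simp add: distrib_right)
      then show False using t(2) v(2) by linarith
    qed
    then have "decode_bits x \<notin> compressible V T" using ex[of x] by blast
    then have "ereal (T * real (n - 1)) \<le> ereal_of_enat (H_C V (decode_bits x))"
      using x(1) by (simp add: compressible_def not_less code_length_def)
    also have "\<dots> \<le> ereal_of_enat (enat (length p + d))"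
      using d[OF Cp] by (simp only: ereal_of_enat_le_iff)
    finally have "T * real (n - 1) \<le> real (length p + d)" by simp
    moreover have "T * real n = T * real (n - 1) + T" using n by (simp add: of_nat_diff algebra_simps)
    ultimately have "T * real n - real (d + 1) \<le> real (length p)" using T by simp
    then show ?thesis unfolding p(2) by simp
  qed
  then show ?thesis unfolding weakly_chaitin_random_def by blast
qed

section \<open>Compressibility\<close>

context enumerated_sum
begin

definition prefix_value :: "nat \<Rightarrow> nat \<Rightarrow> nat" where
  "prefix_value t n = numerator t * 2 ^ n div 2 ^ t"

lemma rec2_prefix_value: "rec2 prefix_value"
  unfolding prefix_value_def rec2_def by (intro recfun_intros rec1_comp[OF rec1_numerator])

lemma partial_nonneg: "0 \<le> partial t"
  unfolding partial_def by (rule sum_nonneg) simp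

lemma prefix_value_floor: "prefix_value t n = nat \<lfloor>partial t * 2 ^ n\<rfloor>"
proof -
  have "real (numerator t * 2 ^ n) / real (2 ^ t) = partial t * 2 ^ n"
    by (simp add: numerator_eq)
  then show ?thesis
    unfolding prefix_value_def using floor_divide_of_nat_eq[of "numerator t * 2 ^ n" "2 ^ t", where ?'a = real] by simp
qed

lemma prefix_value_mono: "t \<le> t' \<Longrightarrow> prefix_value t n \<le> prefix_value t' n"
  unfolding prefix_value_floor by (intro nat_mono floor_mono mult_right_mono partial_mono) auto

lemma prefix_value_le: "prefix_value t n \<le> nat \<lfloor>\<theta> * 2 ^ n\<rfloor>"
  unfolding prefix_value_floor by (intro nat_mono floor_mono mult_right_mono partial_le) auto

text \<open>The partial sums need not reach a dyadic limit, and then their \<open>n\<close>-bit prefixes are eventually one unit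
  too small. This happens for all \<open>n\<close> from some point on, so the correction is a threshold function.\<close>

lemma prefix_value_correction:
  obtains \<delta> where "rec1 \<delta>" "\<And>n. \<exists>t0. \<forall>t\<ge>t0. prefix_value t n + \<delta> n = nat \<lfloor>\<theta> * 2 ^ n\<rfloor>"
proof -
  define z where "z n = nat \<lfloor>\<theta> * 2 ^ n\<rfloor>" for n
  have \<theta>: "0 \<le> \<theta>" using partial_nonneg partial_le by (rule order_trans)
  have z: "real (z n) \<le> \<theta> * 2 ^ n" for n
    unfolding z_def using \<theta> by (simp add: of_nat_floor)
  define Q where "Q n \<longleftrightarrow> (\<exists>t. prefix_value t n = z n)" for n
  have val: "partial t * 2 ^ n < real k \<longleftrightarrow> prefix_value t n < k" for t n k
    unfolding prefix_value_floor using partial_nonneg[of t] by (simp add: nat_less_iff floor_less_iff)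
  have lim: "\<exists>t0. \<forall>t\<ge>t0. y < partial t * 2 ^ n" if "y < \<theta> * 2 ^ n" for y n
  proof -
    have "(\<lambda>t. partial t * 2 ^ n) \<longlonglongrightarrow> \<theta> * 2 ^ n" by (intro tendsto_mult_right partial_tendsto)
    then have "eventually (\<lambda>t. y < partial t * 2 ^ n) sequentially" using that by (rule order_tendstoD)
    then show ?thesis unfolding eventually_sequentially .
  qed
  have notQ: "prefix_value t n < z n" if "\<not> Q n" for t n
    using that prefix_value_le[of t n] unfolding Q_def z_def[symmetric] by (metis le_neq_implies_less)
  have notQ_eq: "\<theta> * 2 ^ n = real (z n)" if "\<not> Q n" for n
  proof (rule ccontr)
    assume "\<theta> * 2 ^ n \<noteq> real (z n)"
    then have "real (z n) < \<theta> * 2 ^ n" using z[of n] by simp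
    then obtain t where "real (z n) < partial t * 2 ^ n" using lim by blast
    moreover have "partial t * 2 ^ n < real (z n)" unfolding val by (rule notQ[OF that])
    ultimately show False by simp
  qed
  \<comment> \<open>If level \<open>n\<close> is never reached, \<theta> 2^n is an integer and all
    partial sums stay strictly below \<theta>. Then \<theta> 2^m is an integer as well and cannot be
    reached either.\<close>
  have up: "\<not> Q m" if nQ: "\<not> Q n" and nm: "n \<le> m" for n m
  proof
    assume "Q m"
    then obtain t where t: "prefix_value t m = z m" unfolding Q_def by blast
    have "partial t * 2 ^ n < \<theta> * 2 ^ n"
      unfolding notQ_eq[OF nQ] val by (rule notQ[OF nQ])
    then have "partial t < \<theta>" by simp
    have "(2::real) ^ m = 2 ^ n * 2 ^ (m - n)" using nm by (simp flip: power_add)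
    then have int: "\<theta> * 2 ^ m = real (z n * 2 ^ (m - n))" using notQ_eq[OF nQ] by simp
    then have "z m = z n * 2 ^ (m - n)" unfolding z_def[of m] by (simp only: floor_of_nat nat_int)
    then have "\<theta> * 2 ^ m = real (z m)" using int by simp
    moreover have "partial t * 2 ^ m < \<theta> * 2 ^ m" using \<open>partial t < \<theta>\<close> by simp
    ultimately have "prefix_value t m < z m" unfolding val[symmetric] by simp
    then show False using t by simp
  qed
  define \<delta> where "\<delta> n = (of_bool (\<not> Q n) :: nat)" for n
  \<comment> \<open>The threshold \<open>n1\<close> is not computed; its existence is enough, since
    every threshold function is recursive.\<close>
  have "rec1 \<delta>"
  proof (cases "\<exists>n. \<not> Q n")
    case True
    then obtain n1 where n1: "\<not> Q n1" "\<And>n. n < n1 \<Longrightarrow> Q n"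
      using exists_least_iff[of "\<lambda>n. \<not> Q n"] by blast
    have "\<delta> n = of_bool (n1 \<le> n)" for n
      using n1(2)[of n] up[OF n1(1), of n] by (cases "n1 \<le> n") (simp_all add: \<delta>_def)
    then have "\<delta> = (\<lambda>n. of_bool (n1 \<le> n))" by (rule ext)
    then show ?thesis unfolding rec1_def by (simp only:) (intro recfun_intros)
  next
    case False
    then have "\<delta> = (\<lambda>_. 0)" by (auto simp: \<delta>_def)
    then show ?thesis unfolding rec1_def by (simp add: recfun_const)
  qed
  moreover have "\<exists>t0. \<forall>t\<ge>t0. prefix_value t n + \<delta> n = z n" for n
  proof (cases "Q n")
    case True
    then obtain t0 where t0: "prefix_value t0 n = z n" unfolding Q_def by blast
    have "prefix_value t n = z n" if "t \<ge> t0" for t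
      using prefix_value_mono[OF that, of n] prefix_value_le[of t n] t0 unfolding z_def by simp
    then show ?thesis using True by (auto simp: \<delta>_def)
  next
    case False
    \<comment> \<open>Late partial sums, times \<open>2 ^ n\<close>, lie in the last unit below the
      integer \<open>z n\<close>, so their floor is \<open>z n - 1\<close>.\<close>
    have "real (z n) - 1 < \<theta> * 2 ^ n" using z[of n] by simp
    then obtain t0 where t0: "\<forall>t\<ge>t0. real (z n) - 1 < partial t * 2 ^ n" using lim by blast
    have "prefix_value t n + 1 = z n" if "t \<ge> t0" for t
    proof -
      have lt: "prefix_value t n < z n" by (rule notQ[OF False])
      have "\<not> partial t * 2 ^ n < real (z n - 1)" using t0 that lt by (simp add: of_nat_diff not_less less_imp_le)
      then show ?thesis using lt unfolding val by simp
    qed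
    then show ?thesis using False by (auto simp: \<delta>_def)
  qed
  ultimately show thesis using that unfolding z_def by blast
qed

text \<open>The number of strings of length at most \<open>n\<close> plus the rounded-down weight of the longer ones is a
  potential that increases at each change.\<close>

lemma prefix_value_changes:
  "real (\<Sum>t<Suc N. of_bool (0 < t \<and> prefix_value (t - 1) n \<noteq> prefix_value t n))
    \<le> (\<Sum>x | E N x. min 1 (2 ^ n * (1/2) ^ code_length x))"
proof -
  \<comment> \<open>Times \<open>2 ^ n\<close>, the short strings contribute an integer
    \<open>S t\<close> and the long ones a real \<open>L t\<close>, of which only the floor affects
    the prefix value.\<close>
  define K where "K t = {x. E t x \<and> code_length x \<le> n}" for t
  define L where "L t = (\<Sum>x | E t x \<and> \<not> code_length x \<le> n. 2 ^ n * (1/2::real) ^ code_length x)" for t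
  define S where "S t = (\<Sum>x\<in>K t. 2 ^ (n - code_length x) :: nat)" for t
  define R where "R t = card (K t) + nat \<lfloor>L t\<rfloor>" for t
  have finK: "finite (K t)" and finL: "finite {x. E t x \<and> \<not> code_length x \<le> n}" for t
    using finite_E[of t] unfolding K_def by (auto intro: rev_finite_subset)
  have L0: "0 \<le> L t" for t unfolding L_def by (rule sum_nonneg) simp
  have split: "(\<Sum>x | E t x. f x) = (\<Sum>x\<in>K t. f x) + (\<Sum>x | E t x \<and> \<not> code_length x \<le> n. f x)"
    for t and f :: "nat \<Rightarrow> real"
    using sum.Int_Diff[OF finite_E[of t], of f "{x. code_length x \<le> n}"]
    by (simp add: K_def Int_def set_diff_eq)
  have "partial t * 2 ^ n = real (S t) + L t" for t
  proof -
    have "partial t * 2 ^ n = (\<Sum>x | E t x. 2 ^ n * (1/2) ^ code_length x)"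
      unfolding partial_def sum_distrib_right by (simp only: mult.commute)
    also have "\<dots> = (\<Sum>x\<in>K t. 2 ^ n * (1/2) ^ code_length x) + L t"
      unfolding split L_def ..
    also have "(\<Sum>x\<in>K t. 2 ^ n * (1/2::real) ^ code_length x) = real (S t)"
      unfolding S_def of_nat_sum by (intro sum.cong refl) (simp only: K_def mem_Collect_eq real_two_power_diff)
    finally show ?thesis .
  qed
  then have v: "prefix_value t n = S t + nat \<lfloor>L t\<rfloor>" for t
    unfolding prefix_value_floor using L0[of t] by (simp add: nat_add_distrib)
  have step: "R t + of_bool (prefix_value t n \<noteq> prefix_value (Suc t) n) \<le> R (Suc t)" for t
  proof -
    have E: "E (Suc t) x" if "E t x" for x using mono_E[OF that, of "Suc t"] by simp
    have sub: "K t \<subseteq> K (Suc t)" unfolding K_def using E by blast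
    then have card: "card (K t) \<le> card (K (Suc t))" by (rule card_mono[OF finK])
    have "L t \<le> L (Suc t)" unfolding L_def by (rule sum_mono2[OF finL]) (use E in auto)
    then have fl: "nat \<lfloor>L t\<rfloor> \<le> nat \<lfloor>L (Suc t)\<rfloor>" by (intro nat_mono floor_mono)
    \<comment> \<open>If the potential does not grow, neither of its monotone parts does: no short
      string is new and the floor is the same, so the prefix value is unchanged.\<close>
    have "prefix_value t n = prefix_value (Suc t) n" if "R (Suc t) \<le> R t"
    proof -
      have "card (K t) = card (K (Suc t))" and *: "nat \<lfloor>L t\<rfloor> = nat \<lfloor>L (Suc t)\<rfloor>"
        using that card fl unfolding R_def by linarith+
      then have "K t = K (Suc t)" using card_subset_eq[OF finK sub] by simp
      then show ?thesis unfolding v S_def * by simp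
    qed
    moreover have "R t \<le> R (Suc t)" unfolding R_def using card fl by simp
    ultimately show ?thesis by (cases "R (Suc t) \<le> R t") auto
  qed
  have "(\<Sum>t<Suc N. of_bool (0 < t \<and> prefix_value (t - 1) n \<noteq> prefix_value t n)) \<le> R N"
  proof (induction N)
    case (Suc N)
    have "(\<Sum>t<Suc (Suc N). of_bool (0 < t \<and> prefix_value (t - 1) n \<noteq> prefix_value t n)) =
       (\<Sum>t<Suc N. of_bool (0 < t \<and> prefix_value (t - 1) n \<noteq> prefix_value t n)) +
       (of_bool (prefix_value N n \<noteq> prefix_value (Suc N) n) :: nat)"
      by (subst sum.lessThan_Suc) simp
    also have "\<dots> \<le> R N + of_bool (prefix_value N n \<noteq> prefix_value (Suc N) n)"
      by (intro add_right_mono Suc.IH)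
    also have "\<dots> \<le> R (Suc N)" by (rule step)
    finally show ?case .
  qed simp
  then have "real (\<Sum>t<Suc N. of_bool (0 < t \<and> prefix_value (t - 1) n \<noteq> prefix_value t n)) \<le> real (R N)"
    by (simp only: of_nat_le_iff)
  also have "\<dots> \<le> real (card (K N)) + L N" unfolding R_def using L0[of N] by (simp add: of_nat_floor)
  also have "real (card (K N)) = (\<Sum>x\<in>K N. min 1 (2 ^ n * (1/2) ^ code_length x))"
  proof -
    have "min 1 (2 ^ n * (1/2::real) ^ code_length x) = 1" if "x \<in> K N" for x
    proof -
      have "code_length x \<le> n" using that by (simp add: K_def)
      from real_two_power_diff[OF this] have "2 ^ n * (1/2::real) ^ code_length x \<ge> 1" by (metis of_nat_1 of_nat_le_iff one_le_numeral one_le_power)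
      then show ?thesis by (rule min_absorb1)
    qed
    then show ?thesis by simp
  qed
  also have "L N = (\<Sum>x | E N x \<and> \<not> code_length x \<le> n. min 1 (2 ^ n * (1/2) ^ code_length x))"
    unfolding L_def
  proof (rule sum.cong[OF refl])
    fix x assume "x \<in> {x. E N x \<and> \<not> code_length x \<le> n}"
    then have "n \<le> code_length x" by simp
    then have "(1/2::real) ^ code_length x \<le> (1/2) ^ n" by (intro power_decreasing) auto
    then have "2 ^ n * (1/2::real) ^ code_length x \<le> 2 ^ n * (1/2) ^ n" by (intro mult_left_mono) auto
    also have "\<dots> = 1" by (simp add: power_one_over)
    finally show "2 ^ n * (1/2::real) ^ code_length x = min 1 (2 ^ n * (1/2) ^ code_length x)"
      by (rule min_absorb2[symmetric])
  qed
  also have "(\<Sum>x\<in>K N. min 1 (2 ^ n * (1/2) ^ code_length x)) +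
      (\<Sum>x | E N x \<and> \<not> code_length x \<le> n. min 1 (2 ^ n * (1/2) ^ code_length x)) =
      (\<Sum>x | E N x. min 1 (2 ^ n * (1/2::real) ^ code_length x))"
    by (rule split[symmetric])
  finally show ?thesis .
qed

end

text \<open>The error 1/n of the n-th approximation becomes less than 1 after multiplication by n,
  and the floor loses less than 1 more; adding 2 gives an upper bound that exceeds T n by at most
  3.\<close>

lemma computable_linear_bound:
  assumes "computable_real T" "0 < T"
  obtains l where "rec1 l" "\<And>n. T * real n \<le> real (l n)" "\<And>n. real (l n) \<le> T * real n + 3"
proof -
  obtain f where f: "recursive_rat_seq f" "\<And>n. n \<ge> 1 \<Longrightarrow> \<bar>T - of_rat (f n)\<bar> < 1 / real n"
    using assms(1) unfolding computable_real_def by blast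
  obtain sg num den where r: "rec1 sg" "rec1 num" "rec1 den"
    "\<And>n. f n = (if sg n = 0 then 1 else -1) * of_nat (num n) / of_nat (den n + 1)"
    using f(1) unfolding recursive_rat_seq_def total_recursive_iff_rec1 by blast
  define q where "q n = (if sg n = 0 then num n * n div (den n + 1) else 0)" for n
  have "rec1 (\<lambda>n. q n + 2)"
    unfolding q_def rec1_def
    by (intro recfun_intros rec1_comp[OF r(1)] rec1_comp[OF r(2)] rec1_comp[OF r(3)])
  moreover have "T * real n \<le> real (q n + 2) \<and> real (q n + 2) \<le> T * real n + 3" for n
  proof (cases "n = 0")
    case True
    then show ?thesis by (simp add: q_def)
  next
    case False
    define y where "y = real n * real_of_rat (f n)"
    have "real n * \<bar>T - of_rat (f n)\<bar> < 1" using f(2)[of n] False by (simp add: field_simps)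
    then have "\<bar>real n * (T - of_rat (f n))\<bar> < 1" by (simp add: abs_mult)
    then have y: "\<bar>T * real n - y\<bar> < 1" by (simp add: y_def algebra_simps)
    show ?thesis
    proof (cases "sg n = 0")
      case True
      have "y = real (num n * n) / real (den n + 1)"
        by (simp add: y_def r(4) True of_rat_divide of_rat_add)
      then have "\<lfloor>y\<rfloor> = int (q n)"
        using floor_divide_of_nat_eq[of "num n * n" "den n + 1", where ?'a = real] True by (simp add: q_def)
      then have "real (q n) \<le> y" "y < real (q n) + 1" by linarith+
      then show ?thesis using y by linarith
    next
      case False
      have "y = - (real n * (real (num n) / real (den n + 1)))"
        using False by (simp add: y_def r(4) of_rat_divide of_rat_add of_rat_minus)
      moreover have "0 \<le> real n * (real (num n) / real (den n + 1))" by simp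
      ultimately have "y \<le> 0" by linarith
      moreover have "0 \<le> T * real n" using assms(2) by simp
      moreover have "q n = 0" using False by (simp add: q_def)
      ultimately show ?thesis using y by simp
    qed
  qed
  ultimately show thesis using that[of "\<lambda>n. q n + 2"] by blast
qed

text \<open>Split at n = L. Below, the terms are at most 2^-L (2\<rho>)^n, a growing geometric
  series as \<rho> > 1/2; from L on they are at most \<rho>^n, a decaying one. Both parts are
  bounded by constant multiples of \<rho>^L.\<close>

lemma truncated_geometric_sum:
  fixes \<rho> :: real
  assumes "1/2 < \<rho>" "\<rho> < 1"
  shows "(\<Sum>n<N. \<rho> ^ n * min 1 (2 ^ n * (1/2) ^ L)) \<le> (1 / (1 - \<rho>) + 1 / (2 * \<rho> - 1)) * \<rho> ^ L"
proof -
  let ?a = "\<lambda>n. \<rho> ^ n * min 1 (2 ^ n * (1/2) ^ L)"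
  have "(\<Sum>n<N. ?a n) \<le> (\<Sum>n<L + N. ?a n)"
    by (rule sum_mono2) (use assms in auto)
  also have "\<dots> = (\<Sum>n<L. ?a n) + (\<Sum>k<N. ?a (L + k))"
    by (induction N) simp_all
  also have "(\<Sum>n<L. ?a n) \<le> (\<Sum>n<L. (1/2) ^ L * (2 * \<rho>) ^ n)"
  proof (rule sum_mono)
    fix n
    have "?a n \<le> \<rho> ^ n * (2 ^ n * (1/2) ^ L)" using assms by (intro mult_left_mono) auto
    then show "?a n \<le> (1/2) ^ L * (2 * \<rho>) ^ n" by (simp add: power_mult_distrib mult_ac)
  qed
  also have "(\<Sum>n<L. (1/2) ^ L * (2 * \<rho>) ^ n) \<le> \<rho> ^ L / (2 * \<rho> - 1)"
  proof -
    have "(\<Sum>n<L. (2 * \<rho>) ^ n) = ((2 * \<rho>) ^ L - 1) / (2 * \<rho> - 1)"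
      by (rule geometric_sum) (use assms in auto)
    also have "\<dots> \<le> (2 * \<rho>) ^ L / (2 * \<rho> - 1)" using assms by (intro divide_right_mono) auto
    finally have "(1/2) ^ L * (\<Sum>n<L. (2 * \<rho>) ^ n) \<le> (1/2) ^ L * ((2 * \<rho>) ^ L / (2 * \<rho> - 1))"
      by (rule mult_left_mono) simp
    moreover have "(1/2) ^ L * (2 * \<rho>) ^ L = \<rho> ^ L" unfolding power_mult_distrib[symmetric] by simp
    ultimately show ?thesis by (simp only: sum_distrib_left times_divide_eq_right)
  qed
  also have "(\<Sum>k<N. ?a (L + k)) \<le> \<rho> ^ L / (1 - \<rho>)"
  proof -
    have "(\<Sum>k<N. ?a (L + k)) \<le> (\<Sum>k<N. \<rho> ^ L * \<rho> ^ k)"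
    proof (rule sum_mono)
      fix k
      have "?a (L + k) \<le> \<rho> ^ (L + k) * 1" using assms by (intro mult_left_mono) auto
      then show "?a (L + k) \<le> \<rho> ^ L * \<rho> ^ k" by (simp add: power_add)
    qed
    also have "\<dots> = \<rho> ^ L * (\<Sum>k<N. \<rho> ^ k)" by (simp add: sum_distrib_left)
    also have "\<dots> \<le> \<rho> ^ L * (1 / (1 - \<rho>))"
      using assms by (intro mult_left_mono geometric_sum_le) auto
    finally show ?thesis by simp
  qed
  finally show ?thesis by (simp add: algebra_simps)
qed

text \<open>A request number stands for a pair of a stage and a level. The weight of the active
  requests is summed over stages by counting changes, then over levels by the truncated geometric
  sum, and finally over strings by \<open>weight\<close>.\<close>

lemma (in enumerated_sum) strictly_compressible_sum:
  assumes U: "optimal_machine U" and T: "0 < T" "T < 1" "computable_real T"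
    and weight: "\<And>t. (\<Sum>x | E t x. ((1/2) powr T) ^ code_length x) \<le> 1"
    and \<theta>: "0 \<le> \<theta>" "\<theta> < 1"
  shows "strictly_compressible U T \<theta>"
proof -
  define \<rho> where "\<rho> = (1/2::real) powr T"
  have \<rho>: "1/2 < \<rho>" "\<rho> < 1"
  proof -
    have "(1/2::real) powr 1 < (1/2) powr T" by (rule powr_less_mono') (use T in auto)
    then show "1/2 < \<rho>" by (simp add: \<rho>_def)
    have "(1/2::real) powr T < (1/2) powr 0" by (rule powr_less_mono') (use T in auto)
    then show "\<rho> < 1" by (simp add: \<rho>_def)
  qed
  obtain l where l: "rec1 l" and lo: "\<And>n. T * real n \<le> real (l n)" and hi: "\<And>n. real (l n) \<le> T * real n + 3"
    using computable_linear_bound[OF T(3,1)] by blast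
  obtain \<delta> where \<delta>: "rec1 \<delta>" "\<And>n. \<exists>t0. \<forall>t\<ge>t0. prefix_value t n + \<delta> n = nat \<lfloor>\<theta> * 2 ^ n\<rfloor>"
    using prefix_value_correction by blast
  \<comment> \<open>The case \<open>t = n\<close> issues the initial request of level
    \<open>n\<close>; \<open>n \<le> t\<close> keeps \<open>n\<close> below \<open>2 ^ t\<close>, as
    the numbering of pairs requires.\<close>
  define active where "active t n \<longleftrightarrow> n \<le> t \<and> (t = n \<or> prefix_value (t - 1) n \<noteq> prefix_value t n)" for t n
  have active: "recpred2 active"
    unfolding active_def recpred2_def by (intro recfun_intros rec2_comp[OF rec2_prefix_value])
  define snd_arg where "snd_arg i = i + 1 - 2 ^ code_length i" for i
  have snd_arg: "rec1 snd_arg"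
    unfolding snd_arg_def rec1_def by (intro recfun_intros rec1_comp[OF rec1_code_length])
  define act where "act i \<longleftrightarrow> active (code_length i) (snd_arg i)" for i
  have act: "recpred1 act"
    unfolding act_def recpred1_def
    by (intro recpred2_comp[OF active] rec1_comp[OF rec1_code_length] rec1_comp[OF snd_arg] recfun_intros)
  have l': "rec1 (\<lambda>i. l (snd_arg i))"
    unfolding rec1_def by (intro rec1_comp[OF l] rec1_comp[OF snd_arg] recfun_intros)
  \<comment> \<open>The correction is built into the request, so that the bits of a dyadic limit are
    requested even if no stage attains them.\<close>
  define \<sigma> where "\<sigma> i = code_bits (bin (snd_arg i) (prefix_value (code_length i) (snd_arg i) + \<delta> (snd_arg i)))" for i
  have \<sigma>: "rec1 \<sigma>"
    unfolding \<sigma>_def rec1_def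
    by (intro rec2_comp[OF rec2_code_bin] rec2_comp[OF rec2_prefix_value] rec1_comp[OF \<delta>(1)]
        rec1_comp[OF snd_arg] rec1_comp[OF rec1_code_length] recfun_intros)
  \<comment> \<open>The first summand pays for the initial request of each level, the rest for the
    changes.\<close>
  define B where "B = 1 / (1 - \<rho>) + (1 / (1 - \<rho>) + 1 / (2 * \<rho> - 1))"
  have weight_n: "(1/2::real) ^ l n \<le> \<rho> ^ n" for n
  proof -
    have "(1/2::real) ^ l n = (1/2) powr real (l n)" by (simp add: powr_realpow)
    also have "\<dots> \<le> (1/2) powr (T * real n)" using lo[of n] by (intro powr_mono') auto
    also have "\<dots> = \<rho> ^ n" unfolding \<rho>_def by (rule powr_power_real[symmetric])
    finally show ?thesis .
  qed
  have count: "(\<Sum>t<N. of_bool (active t n)) \<le> 1 + (\<Sum>x | E N x. min 1 (2 ^ n * (1/2::real) ^ code_length x))"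
    for N n
  proof -
    let ?ch = "\<lambda>t. 0 < t \<and> prefix_value (t - 1) n \<noteq> prefix_value t n"
    have "(\<Sum>t<N. of_bool (active t n)) \<le> (\<Sum>t<Suc N. of_bool (t = n) + of_bool (?ch t) :: real)"
    proof (rule order_trans)
      show "(\<Sum>t<N. of_bool (active t n)) \<le> (\<Sum>t<N. of_bool (t = n) + of_bool (?ch t) :: real)"
        by (rule sum_mono) (auto simp: active_def)
      show "(\<Sum>t<N. of_bool (t = n) + of_bool (?ch t) :: real) \<le> (\<Sum>t<Suc N. of_bool (t = n) + of_bool (?ch t))"
        by (rule sum_mono2) auto
    qed
    also have "\<dots> = (\<Sum>t<Suc N. of_bool (t = n)) + real (\<Sum>t<Suc N. of_bool (?ch t))"
      by (simp only: sum.distrib of_nat_sum of_nat_of_bool)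
    also have "(\<Sum>t<Suc N. of_bool (t = n) :: real) \<le> 1"
    proof -
      have "(\<Sum>t<Suc N. of_bool (t = n) :: real) = (\<Sum>t<Suc N. if t = n then 1 else 0)"
        by (simp only: of_bool_def)
      also have "\<dots> \<le> 1" by (subst sum.delta) auto
      finally show ?thesis .
    qed
    also note prefix_value_changes[of n N]
    finally show ?thesis by simp
  qed
  have bound: "(\<Sum>i<N. of_bool (act i) * (1/2) ^ l (snd_arg i)) \<le> B" for N
  proof -
    have "(\<Sum>i<N. of_bool (act i) * (1/2::real) ^ l (snd_arg i)) \<le> (\<Sum>i<2 ^ N - 1. of_bool (act i) * (1/2) ^ l (snd_arg i))"
      by (rule sum_mono2) (use le_two_power_minus_one[of N] in auto)
    also have "\<dots> = (\<Sum>t<N. \<Sum>n<2 ^ t. of_bool (active t n) * (1/2) ^ l n)"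
      unfolding act_def snd_arg_def by (rule sum_code_pairs)
    \<comment> \<open>Activity forces n \<le> t < N, so the range of \<open>n\<close> can be made
      independent of \<open>t\<close> before the sums are swapped.\<close>
    also have "\<dots> = (\<Sum>t<N. \<Sum>n<N. of_bool (active t n) * (1/2) ^ l n)"
    proof (rule sum.cong[OF refl])
      fix t assume "t \<in> {..<N}"
      then have t: "t < N" by simp
      have "Suc t \<le> 2 ^ t" by (rule Suc_leI) simp
      then have "(\<Sum>n<2 ^ t. of_bool (active t n) * (1/2::real) ^ l n) = (\<Sum>n<Suc t. of_bool (active t n) * (1/2) ^ l n)"
        by (intro sum.mono_neutral_right) (auto simp: active_def)
      also have "\<dots> = (\<Sum>n<N. of_bool (active t n) * (1/2) ^ l n)"
        using t by (intro sum.mono_neutral_left) (auto simp: active_def)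
      finally show "(\<Sum>n<2 ^ t. of_bool (active t n) * (1/2::real) ^ l n) = (\<Sum>n<N. of_bool (active t n) * (1/2) ^ l n)" .
    qed
    also have "\<dots> = (\<Sum>n<N. \<Sum>t<N. of_bool (active t n) * (1/2) ^ l n)" by (rule sum.swap)
    also have "\<dots> = (\<Sum>n<N. (\<Sum>t<N. of_bool (active t n)) * (1/2) ^ l n)" by (simp only: sum_distrib_right)
    also have "\<dots> \<le> (\<Sum>n<N. (1 + (\<Sum>x | E N x. min 1 (2 ^ n * (1/2) ^ code_length x))) * \<rho> ^ n)"
      by (intro sum_mono mult_mono count weight_n sum_nonneg add_nonneg_nonneg) auto
    also have "\<dots> = (\<Sum>n<N. \<rho> ^ n) + (\<Sum>n<N. \<Sum>x | E N x. \<rho> ^ n * min 1 (2 ^ n * (1/2) ^ code_length x))"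
    proof -
      have "(1 + (\<Sum>x | E N x. min 1 (2 ^ n * (1/2) ^ code_length x))) * \<rho> ^ n =
          \<rho> ^ n + (\<Sum>x | E N x. \<rho> ^ n * min 1 (2 ^ n * (1/2) ^ code_length x))" for n
        by (simp only: sum_distrib_right distrib_right mult_1_left mult.commute[of "\<rho> ^ n"])
      then show ?thesis by (simp only: sum.distrib)
    qed
    also have "(\<Sum>n<N. \<Sum>x | E N x. \<rho> ^ n * min 1 (2 ^ n * (1/2) ^ code_length x)) =
        (\<Sum>x | E N x. \<Sum>n<N. \<rho> ^ n * min 1 (2 ^ n * (1/2) ^ code_length x))" by (rule sum.swap)
    also have "\<dots> \<le> (\<Sum>x | E N x. (1 / (1 - \<rho>) + 1 / (2 * \<rho> - 1)) * \<rho> ^ code_length x)"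
      by (intro sum_mono truncated_geometric_sum \<rho>)
    also have "\<dots> = (1 / (1 - \<rho>) + 1 / (2 * \<rho> - 1)) * (\<Sum>x | E N x. \<rho> ^ code_length x)"
      by (simp only: sum_distrib_left)
    also have "\<dots> \<le> (1 / (1 - \<rho>) + 1 / (2 * \<rho> - 1)) * 1"
      using weight[of N] \<rho> unfolding \<rho>_def[symmetric] by (intro mult_left_mono) auto
    also have "(\<Sum>n<N. \<rho> ^ n) \<le> 1 / (1 - \<rho>)" using \<rho> by (intro geometric_sum_le) auto
    finally show ?thesis unfolding B_def by simp
  qed
  obtain d where d: "\<And>i. act i \<Longrightarrow> H_C U (decode_bits (\<sigma> i)) \<le> enat (l (snd_arg i) + d)"
    using optimal_machine_requests[OF U act l' \<sigma> bound] by blast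
  have frac: "frac \<theta> = \<theta>" using \<theta> by (simp add: frac_eq)
  have "ereal_of_enat (H_C U (restr \<theta> n)) \<le> ereal (T * real n + real (3 + d))" for n
  proof -
    obtain t0 where t0: "\<forall>t\<ge>t0. prefix_value t n + \<delta> n = nat \<lfloor>\<theta> * 2 ^ n\<rfloor>" using \<delta>(2) by blast
    \<comment> \<open>At the first stage from \<open>n\<close> on with the correct value, either the
      level has just been opened or the value has just changed; in both cases the request is
      active.\<close>
    let ?Q = "\<lambda>t. n \<le> t \<and> prefix_value t n + \<delta> n = nat \<lfloor>\<theta> * 2 ^ n\<rfloor>"
    define t where "t = (LEAST t. ?Q t)"
    have "?Q (max t0 n)" using t0 by simp
    then have Qt: "?Q t" unfolding t_def by (rule LeastI)
    have less: "\<not> ?Q t'" if "t' < t" for t' using that unfolding t_def by (rule not_less_Least)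
    have "active t n"
    proof (cases "t = n")
      case True
      then show ?thesis by (simp add: active_def)
    next
      case False
      then have "n \<le> t - 1" "t - 1 < t" using Qt by auto
      then have "prefix_value (t - 1) n + \<delta> n \<noteq> prefix_value t n + \<delta> n" using less[of "t - 1"] Qt by metis
      then show ?thesis using Qt by (simp add: active_def)
    qed
    define i where "i = 2 ^ t - 1 + n"
    have "n < 2 ^ t" using Qt less_exp[of t] by linarith
    then have len: "code_length i = t" unfolding i_def by (intro code_length_unique) auto
    have arg: "snd_arg i = n" unfolding snd_arg_def len by (simp add: i_def)
    have "act i" unfolding act_def len arg by fact
    moreover have "decode_bits (\<sigma> i) = restr \<theta> n"
    proof -
      have "prefix_value t n + \<delta> n = nat \<lfloor>\<theta> * 2 ^ n\<rfloor>" using Qt by blast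
      then show ?thesis unfolding \<sigma>_def len arg restr_eq_bin frac by simp
    qed
    ultimately have "H_C U (restr \<theta> n) \<le> enat (l n + d)" using d[of i] arg by simp
    then have "ereal_of_enat (H_C U (restr \<theta> n)) \<le> ereal_of_enat (enat (l n + d))"
      by (simp only: ereal_of_enat_le_iff)
    also have "\<dots> \<le> ereal (T * real n + real (3 + d))" using hi[of n] by simp
    finally show ?thesis .
  qed
  then show ?thesis unfolding strictly_compressible_def by blast
qed

theorem theorem8:
  fixes U V :: "bool list \<Rightarrow> bool list option" and T :: real
  assumes "optimal_machine U" and "optimal_machine V" and "0 < T"
  shows "(left_computable T \<and> T \<le> 1 \<longrightarrow>
            Theta_bar V T \<noteq> \<infinity> \<and>
            left_computable (enn2real (Theta_bar V T)) \<and>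
            weakly_chaitin_random U T (enn2real (Theta_bar V T)))
       \<and> (computable_real T \<and> T < 1 \<longrightarrow>
            strictly_compressible U T (enn2real (Theta_bar V T)))
       \<and> (1 < T \<longrightarrow> Theta_bar V T = \<infinity>)"
proof -
  let ?\<theta> = "enn2real (Theta_bar V T)"
  have V: "prefix_free_machine V" and pf: "prefix_free (dom V)"
    using assms(2) by (auto simp: optimal_machine_def prefix_free_machine_def)
  \<comment> \<open>\<open>enn2real\<close> sends \<infinity> to 0, so finiteness is recorded along
    with the bounds.\<close>
  have \<theta>: "0 \<le> ?\<theta>" "?\<theta> \<le> 1/2" "Theta_bar V T \<noteq> \<infinity>" if "T \<le> 1"
  proof -
    note fin = Theta_bar_finite[OF pf that]
    show "0 \<le> ?\<theta>" by simp
    show "?\<theta> \<le> 1/2" unfolding fin(2) enn2real_ennreal[OF fin(4)] by (rule fin(3))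
    show "Theta_bar V T \<noteq> \<infinity>" unfolding fin(2) by simp
  qed
  have one: "left_computable ?\<theta> \<and> weakly_chaitin_random U T ?\<theta>" if T: "left_computable T" "T \<le> 1"
  proof -
    obtain a b where "approx_from_below a b T" using left_computable_approx[OF T(1) assms(3)] by blast
    from Theta_bar_enumerated[OF V T(2) this] obtain E where E: "enumerated_sum E ?\<theta>"
      "\<And>x. (\<exists>t. E t x) \<longleftrightarrow> decode_bits x \<in> compressible V T" by blast
    show ?thesis
      using enumerated_sum.left_computable_sum[OF E(1)]
        enumerated_sum.weakly_random[OF E(1) assms(1,2,3) T(2) E(2) \<theta>(1,2)[OF T(2)]] by blast
  qed
  have two: "strictly_compressible U T ?\<theta>" if T: "computable_real T" "T < 1"
  proof -
    have le: "T \<le> 1" using T(2) by simp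
    obtain a b where "approx_from_below a b T" using computable_approx[OF T(1) assms(3)] by blast
    from Theta_bar_enumerated[OF V le this] obtain E where E: "enumerated_sum E ?\<theta>"
      "\<And>x. (\<exists>t. E t x) \<longleftrightarrow> decode_bits x \<in> compressible V T" by blast
    have weight: "(\<Sum>x | E t x. ((1/2) powr T) ^ code_length x) \<le> 1" for t
    proof -
      have fin: "finite {x. E t x}" by (rule enumerated_sum.finite_E[OF E(1)])
      have inj: "inj decode_bits" by (metis code_decode injI)
      have "(\<Sum>x | E t x. ((1/2::real) powr T) ^ code_length x) =
          (\<Sum>s\<in>decode_bits ` {x. E t x}. ((1/2) powr T) ^ length s)"
        by (subst sum.reindex[OF inj_on_subset[OF inj]]) (simp_all add: code_length_def)
      also have "\<dots> \<le> 1"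
      proof (rule compressible_weight(1)[OF pf finite_imageI[OF fin]])
        show "decode_bits ` {x. E t x} \<subseteq> compressible V T" using E(2) by blast
      qed
      finally show ?thesis .
    qed
    have "?\<theta> < 1" using \<theta>(2)[OF le] by simp
    from enumerated_sum.strictly_compressible_sum[OF E(1) assms(1,3) T(2,1) weight \<theta>(1)[OF le] this]
    show ?thesis .
  qed
  show ?thesis using \<theta>(3) one two Theta_bar_infinite[OF assms(2)] by blast
qed

end
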